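(* For every $\beta\in[0,1)$, $$J_\beta^\delta(0)\le 1+e,$$ where $$J_\beta^\delta(0):=\sup\left\{\limsup_{m\to\infty}J_\beta(u_m)\ :\ (u_m)_m\subset H^1_{0,rad}(w_0,B)\ \text{is a sequence that concentrates at } x=0\right\}.$$
   Context: $B\subset\mathbb{R}^2$ is the unit ball centered at the origin, $|B|$ its Lebesgue measure, and $B_r$ is the ball of radius $r$ centered at the origin. For $\beta\in[0,1)$ the weight is $w_0(x)=|\log|x||^\beta$. $H^1_0(w_0,B)$ is the completion of $C_c^\infty(B)$ with respect to the norm $\|u\|_{w_0}=\left(\int_B|\nabla u|^2w_0\,dx\right)^{1/2}$, and $H^1_{0,rad}(w_0,B)$ is its subspace of radial functions. Set $$\alpha_\beta=2\left[2\pi(1-\beta)\right]^{\frac1{1-\beta}},\qquad J_\beta(u)=\frac1{|B|}\int_B e^{\alpha_\beta |u|^{\frac{2}{1-\beta}}}\,dx .$$ A sequence $u_k\in H^1_{0,rad}(w_0,B)$ is said to concentrate at $x=0$ (written $|\nabla u_k|^2w_0\rightharpoonup\delta_0$) if $\|u_k\|_{w_0}\le1$ for all $k$ and, for every $r\in(0,1)$, $\int_{B\setminus B_r}|\nabla u_k|^2w_0\,dx\to0$ as $k\to\infty$. The superscript $\delta$ in $J_\beta^\delta(0)$ is only notation (the "concentration level" at $0$), not a parameter. *)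

theory Defs
  imports "HOL-Analysis.Analysis"
begin

type_synonym plane = "real^2"

abbreviation unit_disc :: "plane set" where
  "unit_disc \<equiv> ball 0 1"

primrec C_k :: "nat \<Rightarrow> (plane \<Rightarrow> real) \<Rightarrow> bool" where
  "C_k 0 f \<longleftrightarrow> continuous_on UNIV f"
| "C_k (Suc k) f \<longleftrightarrow> (\<exists>D. (\<forall>x. GDERIV f x :> D x) \<and> (\<forall>i. C_k k (\<lambda>x. D x $ i)))"

definition test_function :: "(plane \<Rightarrow> real) \<Rightarrow> bool" where
  "test_function \<phi> \<longleftrightarrow> (\<forall>k. C_k k \<phi>) \<and>
     compact (closure {x. \<phi> x \<noteq> 0}) \<and> closure {x. \<phi> x \<noteq> 0} \<subseteq> unit_disc"

definition gradient :: "(plane \<Rightarrow> real) \<Rightarrow> plane \<Rightarrow> plane" where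
  "gradient \<phi> x = (THE D. GDERIV \<phi> x :> D)"

(* At x = 0 this has the junk value 0 (ln 0 = 0), on a null set only. *)
definition w0 :: "real \<Rightarrow> plane \<Rightarrow> real" where
  "w0 \<beta> x = \<bar>ln (norm x)\<bar> powr \<beta>"

(* The completion of the test functions is realized as a space of functions.
   Since 1/w0 is integrable on the disc for \<beta> < 1, a sequence of test functions that is
   Cauchy in the weighted norm converges in L^1 of the disc to some u, and its gradients
   converge in the weighted L^2 space to some g.  The function u determines g almost
   everywhere (g is the weak gradient of u), so u represents the point of the completion
   and g its gradient.  Functions are considered up to null sets; values outside the disc
   are irrelevant. *)
definition H10_gradient :: "real \<Rightarrow> (plane \<Rightarrow> real) \<Rightarrow> (plane \<Rightarrow> plane) \<Rightarrow> bool" where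
  "H10_gradient \<beta> u g \<longleftrightarrow>
     u \<in> borel_measurable (lebesgue_on unit_disc) \<and>
     g \<in> borel_measurable (lebesgue_on unit_disc) \<and>
     (\<exists>\<phi>. (\<forall>n. test_function (\<phi> n)) \<and>
        ((\<lambda>n. \<integral>\<^sup>+x\<in>unit_disc. ennreal ((norm (gradient (\<phi> n) x - g x))\<^sup>2 * w0 \<beta> x) \<partial>lebesgue)
           \<longlonglongrightarrow> 0) \<and>
        ((\<lambda>n. \<integral>\<^sup>+x\<in>unit_disc. ennreal \<bar>\<phi> n x - u x\<bar> \<partial>lebesgue) \<longlonglongrightarrow> 0))"

definition H10 :: "real \<Rightarrow> (plane \<Rightarrow> real) set" where
  "H10 \<beta> = {u. \<exists>g. H10_gradient \<beta> u g}"

definition weak_gradient :: "real \<Rightarrow> (plane \<Rightarrow> real) \<Rightarrow> plane \<Rightarrow> plane" where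
  "weak_gradient \<beta> u = (SOME g. H10_gradient \<beta> u g)"

(* For u in H10 \<beta> the integrand is integrable on the disc, being the square of a limit
   in the weighted L^2 space. *)
definition energy :: "real \<Rightarrow> (plane \<Rightarrow> real) \<Rightarrow> plane set \<Rightarrow> real" where
  "energy \<beta> u A = (LINT x:A|lebesgue. (norm (weak_gradient \<beta> u x))\<^sup>2 * w0 \<beta> x)"

definition weighted_norm :: "real \<Rightarrow> (plane \<Rightarrow> real) \<Rightarrow> real" where
  "weighted_norm \<beta> u = sqrt (energy \<beta> u unit_disc)"

definition radial :: "(plane \<Rightarrow> real) \<Rightarrow> bool" where
  "radial u \<longleftrightarrow> (\<exists>f. AE x in lebesgue_on unit_disc. u x = f (norm x))"

definition H10_rad :: "real \<Rightarrow> (plane \<Rightarrow> real) set" where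
  "H10_rad \<beta> = {u \<in> H10 \<beta>. radial u}"

definition concentrates_at_0 :: "real \<Rightarrow> (nat \<Rightarrow> plane \<Rightarrow> real) \<Rightarrow> bool" where
  "concentrates_at_0 \<beta> u \<longleftrightarrow>
     (\<forall>k. weighted_norm \<beta> (u k) \<le> 1) \<and>
     (\<forall>r\<in>{0<..<1}. (\<lambda>k. energy \<beta> (u k) (unit_disc - ball 0 r)) \<longlonglongrightarrow> 0)"

definition alpha :: "real \<Rightarrow> real" where
  "alpha \<beta> = 2 * (2 * pi * (1 - \<beta>)) powr (1 / (1 - \<beta>))"

(* Valued in ennreal, so that a divergent integral counts as infinity. *)
definition J :: "real \<Rightarrow> (plane \<Rightarrow> real) \<Rightarrow> ennreal" where
  "J \<beta> u = (\<integral>\<^sup>+x\<in>unit_disc. ennreal (exp (alpha \<beta> * \<bar>u x\<bar> powr (2 / (1 - \<beta>)))) \<partial>lebesgue)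
             / emeasure lebesgue unit_disc"

definition concentration_level_0 :: "real \<Rightarrow> ennreal" where
  "concentration_level_0 \<beta> =
     Sup {limsup (\<lambda>m. J \<beta> (u m)) | u. (\<forall>m. u m \<in> H10_rad \<beta>) \<and> concentrates_at_0 \<beta> u}"

end

theory Submission
  imports Defs "HOL-Real_Asymp.Real_Asymp"
begin

text \<open>The proof reduces the statement to a problem on the half-line. In the variable
  \<open>t = - ln (\<bar>x\<bar>\<^sup>2)\<close> normalised Lebesgue measure of the disc becomes \<open>exp (- t) dt\<close>. For \<open>\<beta> = 0\<close>
  and a radial \<open>u = U t\<close>, the function \<open>y = sqrt (4 * pi) * U\<close> has the energy \<open>\<integral> y'\<^sup>2 dt\<close> of \<open>u\<close>, and
  \<open>J u\<close> is \<open>\<integral> exp (y\<^sup>2 - t) dt\<close>. For \<open>\<beta> > 0\<close> a suitable power of the variation of \<open>U\<close> plays the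
  same role (\<open>weighted_moser_bound\<close>), so that the weight disappears without any loss in the
  constants. Concentration means that for fixed \<open>A\<close> the energy in \<open>{0..A}\<close> tends to 0.

  Following Carleson and Chang (\<open>concentrated_moser_bound\<close>), the half-line is split in three
  parts. On \<open>{0..A}\<close> the function \<open>y\<close> is small and the integral is close to 1. As long as
  \<open>y\<^sup>2 \<le> t - 2 * ln t\<close> the integrand is at most \<open>1 / t\<^sup>2\<close>, which contributes at most \<open>1 / A\<close>. If
  \<open>y\<^sup>2\<close> ever reaches \<open>t - 2 * ln t\<close>, then by the Cauchy-Schwarz inequality almost the whole energy
  is spent at that time \<open>a\<close>. With the little energy that is left, \<open>y\<^sup>2\<close> is nearly
  linear in the increment of \<open>y\<close>, and a sharp inequality of Onofri type (\<open>onofri_interval\<close>)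
  bounds the rest of the integral by \<open>exp 1\<close> up to a factor tending to 1 as \<open>A\<close> grows. This
  explains the two summands of \<open>1 + exp 1\<close>.

  An element of the weighted space is a limit of smooth functions that need not be radial. Their
  means over circles are radial and continuously differentiable, do not have larger energy
  in any annulus (\<open>nn_integral_radial_energy_le\<close>), and still converge to the given radial function
  (\<open>nn_integral_circle_mean_diff_le\<close>). So the estimate is needed for
  continuously differentiable profiles only, and Fatou's lemma transfers it (\<open>J_le\<close>).\<close>

section \<open>Increments controlled by derivatives\<close>

lemma deriv_imp_increment_le:
  fixes F G :: "real \<Rightarrow> real"
  assumes "a \<le> b"
    and "\<And>t. a \<le> t \<Longrightarrow> t \<le> b \<Longrightarrow> (F has_real_derivative F' t) (at t)"
    and "\<And>t. a \<le> t \<Longrightarrow> t \<le> b \<Longrightarrow> (G has_real_derivative G' t) (at t)"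
    and "\<And>t. a \<le> t \<Longrightarrow> t \<le> b \<Longrightarrow> F' t \<le> G' t"
  shows "F b - F a \<le> G b - G a"
proof -
  have "G a - F a \<le> G b - F b"
  proof (rule DERIV_nonneg_imp_nondecreasing[OF \<open>a \<le> b\<close>, of "\<lambda>t. G t - F t"])
    fix t assume "a \<le> t" "t \<le> b"
    then show "\<exists>y. ((\<lambda>t. G t - F t) has_real_derivative y) (at t) \<and> 0 \<le> y"
      using assms(2-4)[of t] by (intro exI[of _ "G' t - F' t"] conjI DERIV_diff) auto
  qed
  then show ?thesis by simp
qed

text \<open>The Cauchy-Schwarz inequality for increments, without integrals: integrating
  \<open>2 * \<mu> * V' \<le> \<mu>\<^sup>2 * \<tau>' + E'\<close> bounds the increment of \<open>V\<close> for every constant \<open>\<mu>\<close>, and the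
  best \<open>\<mu>\<close> is the difference quotient of \<open>V\<close> with respect to \<open>\<tau>\<close>.\<close>
lemma square_increment_le:
  fixes V \<tau> E :: "real \<Rightarrow> real"
  assumes "a \<le> b" "\<tau> a < \<tau> b"
    and dV: "\<And>t. a \<le> t \<Longrightarrow> t \<le> b \<Longrightarrow> (V has_real_derivative V' t) (at t)"
    and dtau: "\<And>t. a \<le> t \<Longrightarrow> t \<le> b \<Longrightarrow> (\<tau> has_real_derivative \<tau>' t) (at t)"
    and dE: "\<And>t. a \<le> t \<Longrightarrow> t \<le> b \<Longrightarrow> (E has_real_derivative E' t) (at t)"
    and tau_nonneg: "\<And>t. a \<le> t \<Longrightarrow> t \<le> b \<Longrightarrow> 0 \<le> \<tau>' t"
    and E_nonneg: "\<And>t. a \<le> t \<Longrightarrow> t \<le> b \<Longrightarrow> 0 \<le> E' t"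
    and le: "\<And>t. a \<le> t \<Longrightarrow> t \<le> b \<Longrightarrow> (V' t)\<^sup>2 \<le> \<tau>' t * E' t"
  shows "(V b - V a)\<^sup>2 \<le> (\<tau> b - \<tau> a) * (E b - E a)"
proof -
  define \<mu> where "\<mu> = (V b - V a) / (\<tau> b - \<tau> a)"
  have "2 * \<mu> * V b - 2 * \<mu> * V a \<le> (\<mu>\<^sup>2 * \<tau> b + E b) - (\<mu>\<^sup>2 * \<tau> a + E a)"
  proof (rule deriv_imp_increment_le[OF \<open>a \<le> b\<close>])
    fix t assume t: "a \<le> t" "t \<le> b"
    show "((\<lambda>t. 2 * \<mu> * V t) has_real_derivative 2 * \<mu> * V' t) (at t)"
      using dV[OF t] by (rule DERIV_cmult)
    show "((\<lambda>t. \<mu>\<^sup>2 * \<tau> t + E t) has_real_derivative \<mu>\<^sup>2 * \<tau>' t + E' t) (at t)"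
      using dtau[OF t] dE[OF t] by (intro DERIV_add DERIV_cmult)
    show "2 * \<mu> * V' t \<le> \<mu>\<^sup>2 * \<tau>' t + E' t"
    proof (rule power2_le_imp_le)
      have "(2 * \<mu> * V' t)\<^sup>2 = 4 * \<mu>\<^sup>2 * (V' t)\<^sup>2"
        by (simp add: power_mult_distrib)
      also have "\<dots> \<le> 4 * \<mu>\<^sup>2 * (\<tau>' t * E' t)"
        using le[OF t] by (intro mult_left_mono) auto
      also have "\<dots> \<le> (\<mu>\<^sup>2 * \<tau>' t + E' t)\<^sup>2"
        using zero_le_power2[of "\<mu>\<^sup>2 * \<tau>' t - E' t"] by (simp add: power2_eq_square algebra_simps)
      finally show "(2 * \<mu> * V' t)\<^sup>2 \<le> (\<mu>\<^sup>2 * \<tau>' t + E' t)\<^sup>2" .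
      show "0 \<le> \<mu>\<^sup>2 * \<tau>' t + E' t" using tau_nonneg[OF t] E_nonneg[OF t] by simp
    qed
  qed
  then have *: "2 * \<mu> * (V b - V a) \<le> \<mu>\<^sup>2 * (\<tau> b - \<tau> a) + (E b - E a)"
    by (simp add: algebra_simps)
  have pos: "0 < \<tau> b - \<tau> a" using assms by simp
  have V: "V b - V a = \<mu> * (\<tau> b - \<tau> a)" using pos by (simp add: \<mu>_def)
  have "\<mu>\<^sup>2 * (\<tau> b - \<tau> a) \<le> E b - E a"
    using * unfolding V by (simp add: power2_eq_square)
  then have "\<mu>\<^sup>2 * (\<tau> b - \<tau> a) * (\<tau> b - \<tau> a) \<le> (E b - E a) * (\<tau> b - \<tau> a)"
    using pos by (intro mult_right_mono) auto
  then show ?thesis unfolding V by (simp add: power2_eq_square algebra_simps)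
qed

section \<open>A sharp exponential inequality\<close>

text \<open>The one-dimensional form of the radial Onofri inequality. Up to its total mass \<open>Z\<close>, the
  integrand is a probability density \<open>\<rho>\<close>; let \<open>R t\<close> be its mass beyond \<open>t\<close>. Two pointwise
  estimates are combined. Comparing \<open>\<rho>\<close> with the logistic profile \<open>\<kappa> * R * (1 - R)\<close> through
  \<open>ln x \<le> x - 1\<close> controls the entropy term, and completing a square gives
  \<open>R * \<psi>' \<le> \<kappa> * R\<^sup>2 + \<psi>'\<^sup>2 / (4 * \<kappa>)\<close>. Their sum says that the function \<open>\<Phi>\<close> below decreases no
  faster than \<open>E / (4 * \<kappa>)\<close> increases. Comparing \<open>\<Phi>\<close> at the two ends, where \<open>R\<close> is
  1 and 0, yields the bound for \<open>ln (\<kappa> * Z)\<close>. Both estimates are equalities when \<open>\<rho>\<close> is a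
  logistic density and \<open>\<psi>' = 2 * \<kappa> * R\<close>, which makes the constants sharp on the
  half-line.\<close>
lemma onofri_interval:
  fixes \<psi> E :: "real \<Rightarrow> real"
  assumes aT: "a < T" and \<kappa>: "0 < \<kappa>"
    and d\<psi>: "\<And>t. a \<le> t \<Longrightarrow> t \<le> T \<Longrightarrow> (\<psi> has_real_derivative \<psi>' t) (at t)"
    and dE: "\<And>t. a \<le> t \<Longrightarrow> t \<le> T \<Longrightarrow> (E has_real_derivative E' t) (at t)"
    and le: "\<And>t. a \<le> t \<Longrightarrow> t \<le> T \<Longrightarrow> (\<psi>' t)\<^sup>2 \<le> E' t"
  shows "\<kappa> * integral {a..T} (\<lambda>t. exp (\<psi> t - \<kappa> * t))
      \<le> exp (1 + \<psi> a - \<kappa> * a + (E T - E a) / (4 * \<kappa>))"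
proof -
  define f where "f t = exp (\<psi> t - \<kappa> * t)" for t
  define Z where "Z = integral {a..T} f"
  define R where "R t = 1 - integral {a..t} f / Z" for t
  have cont\<psi>: "continuous_on {a..T} \<psi>"
    by (rule continuous_at_imp_continuous_on) (meson atLeastAtMost_iff d\<psi> DERIV_isCont)
  have contE: "continuous_on {a..T} E"
    by (rule continuous_at_imp_continuous_on) (meson atLeastAtMost_iff dE DERIV_isCont)
  have contf: "continuous_on {a..T} f"
    unfolding f_def by (intro continuous_intros cont\<psi>)
  have dG: "((\<lambda>t. integral {a..t} f) has_real_derivative f t) (at t within {a..T})"
    if "a \<le> t" "t \<le> T" for t
    using integral_has_real_derivative[OF contf, of t] that by auto
  have contR: "continuous_on {a..T} R"
    unfolding R_def divide_inverse
    by (intro continuous_intros indefinite_integral_continuous_1 integrable_continuous_interval contf)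
  have fint: "f integrable_on {a..t}" if "t \<le> T" for t
    using that by (intro integrable_continuous_interval continuous_on_subset[OF contf]) auto
  have fpos: "f t > 0" for t by (simp add: f_def)
  have Gmono: "integral {a..s} f < integral {a..t} f" if "a \<le> s" "s < t" "t \<le> T" for s t
  proof (rule DERIV_pos_imp_increasing_open[OF \<open>s < t\<close>])
    fix x assume x: "s < x" "x < t"
    then have "((\<lambda>t. integral {a..t} f) has_real_derivative f x) (at x within {a<..<T})"
      using that by (intro DERIV_subset[OF dG]) auto
    then show "\<exists>y. ((\<lambda>t. integral {a..t} f) has_real_derivative y) (at x) \<and> 0 < y"
      using x that fpos by (subst (asm) at_within_open) auto
  next
    show "continuous_on {s..t} (\<lambda>t. integral {a..t} f)"
      by (rule continuous_on_subset[OF indefinite_integral_continuous_1[OF fint]]) (use that in auto)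
  qed
  have Zpos: "Z > 0" using Gmono[of a T] aT by (simp add: Z_def)
  have R01: "0 < R t" "R t < 1" if "a < t" "t < T" for t
    using Gmono[of a t] Gmono[of t T] that Zpos by (auto simp: R_def Z_def[symmetric])
  have Ra: "R a = 1" by (simp add: R_def)
  have RT: "R T = 0" using Zpos by (simp add: R_def Z_def[symmetric])
  define L where "L = ln Z + ln \<kappa>"
  define \<Phi> where "\<Phi> t = R t * (\<kappa> * t - \<psi> t + L + ln (R t) - 1) + 1 - (1 - R t) * ln (1 - R t)" for t
  have mono: "\<Phi> s - \<Phi> t \<le> E t / (4 * \<kappa>) - E s / (4 * \<kappa>)" if "a < s" "s \<le> t" "t < T" for s t
  proof -
    have "- \<Phi> t - (- \<Phi> s) \<le> E t / (4 * \<kappa>) - E s / (4 * \<kappa>)"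
    proof (rule deriv_imp_increment_le[OF \<open>s \<le> t\<close>])
      fix x assume "s \<le> x" "x \<le> t"
      with that have x: "a < x" "x < T" by auto
      define \<rho> where "\<rho> = f x / Z"
      have "((\<lambda>t. integral {a..t} f) has_real_derivative f x) (at x within {a<..<T})"
        using x by (intro DERIV_subset[OF dG]) auto
      then have "((\<lambda>t. integral {a..t} f) has_real_derivative f x) (at x)"
        using x by (subst (asm) at_within_open) auto
      then have dR: "(R has_real_derivative - \<rho>) (at x)"
        unfolding R_def \<rho>_def using Zpos by (auto intro!: derivative_eq_intros)
      note R = R01[OF x]
      let ?D = "(-\<rho>) * (\<kappa> * x - \<psi> x + L + ln (R x) + ln (1 - R x) + 1) + R x * (\<kappa> - \<psi>' x)"
      have d1: "((\<lambda>t. ln (R t)) has_real_derivative - \<rho> / R x) (at x)"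
        using R by (auto intro!: derivative_eq_intros dR)
      have d2: "((\<lambda>t. ln (1 - R t)) has_real_derivative \<rho> / (1 - R x)) (at x)"
        using R by (auto intro!: derivative_eq_intros dR)
      have d3: "((\<lambda>t. R t * (\<kappa> * t - \<psi> t + L + ln (R t) - 1)) has_real_derivative
          (-\<rho>) * (\<kappa> * x - \<psi> x + L + ln (R x) - 1) + R x * (\<kappa> - \<psi>' x) - \<rho>) (at x)"
        using x R by (auto intro!: derivative_eq_intros dR d1 d\<psi> simp: field_simps)
      have d4: "((\<lambda>t. (1 - R t) * ln (1 - R t)) has_real_derivative \<rho> * ln (1 - R x) + \<rho>) (at x)"
        using R by (auto intro!: derivative_eq_intros dR d2)
      have "(\<Phi> has_real_derivative ?D) (at x)"
        unfolding \<Phi>_def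
        by (rule DERIV_cong[OF DERIV_diff[OF DERIV_add[OF d3 DERIV_const] d4]]) (simp add: algebra_simps)
      then show "((\<lambda>x. - \<Phi> x) has_real_derivative - ?D) (at x)" by (rule DERIV_minus)
      show "((\<lambda>x. E x / (4 * \<kappa>)) has_real_derivative E' x / (4 * \<kappa>)) (at x)"
        using x by (intro DERIV_cdivide dE) auto
      have \<rho>: "\<rho> > 0" using Zpos fpos by (simp add: \<rho>_def)
      have "ln \<rho> = \<psi> x - \<kappa> * x - ln Z"
        using Zpos by (simp add: \<rho>_def f_def ln_div)
      then have "\<kappa> * x - \<psi> x + L + ln (R x) + ln (1 - R x) = ln (\<kappa> * R x * (1 - R x) / \<rho>)"
        using \<kappa> R \<rho> by (simp add: L_def ln_mult ln_div)
      also have "\<dots> \<le> \<kappa> * R x * (1 - R x) / \<rho> - 1"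
        using \<kappa> R \<rho> by (intro ln_le_minus_one) auto
      finally have "\<rho> * (\<kappa> * x - \<psi> x + L + ln (R x) + ln (1 - R x) + 1)
          \<le> \<rho> * (\<kappa> * R x * (1 - R x) / \<rho>)"
        using \<rho> by (intro mult_left_mono) auto
      also have "\<dots> = \<kappa> * R x * (1 - R x)" using \<rho> by simp
      finally have 1: "- ?D \<le> R x * \<psi>' x - \<kappa> * (R x)\<^sup>2"
        by (simp add: power2_eq_square algebra_simps)
      have "0 \<le> \<kappa> * (R x - \<psi>' x / (2 * \<kappa>))\<^sup>2" using \<kappa> by simp
      also have "\<dots> = \<kappa> * (R x)\<^sup>2 - R x * \<psi>' x + (\<psi>' x)\<^sup>2 / (4 * \<kappa>)"
        using \<kappa> by (simp add: power2_eq_square field_simps)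
      finally have "R x * \<psi>' x - \<kappa> * (R x)\<^sup>2 \<le> (\<psi>' x)\<^sup>2 / (4 * \<kappa>)" by simp
      also have "\<dots> \<le> E' x / (4 * \<kappa>)"
        using le[of x] x \<kappa> by (intro divide_right_mono) auto
      finally show "- ?D \<le> E' x / (4 * \<kappa>)" using 1 by simp
    qed
    then show ?thesis by simp
  qed
  \<comment> \<open>\<open>l \<le> \<Phi> + E / (4 * \<kappa>) \<le> u\<close>, and unlike \<open>\<Phi>\<close> the bounds \<open>l\<close> at \<open>a\<close> and \<open>u\<close> at \<open>T\<close>
      contain no logarithm of 0, so that they are continuous there.\<close>
  define l where "l t = R t * (\<kappa> * t - \<psi> t + L + ln (R t) - 1) + 1 + E t / (4 * \<kappa>)" for t
  define u where "u t = R t * (\<kappa> * t - \<psi> t + L) + 1 + E t / (4 * \<kappa>)" for t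
  have lu: "l s \<le> u t" if st: "a < s" "s \<le> t" "t < T" for s t
  proof -
    have s: "a < s" "s < T" and t: "a < t" "t < T" using st by auto
    have "0 \<le> - ((1 - R s) * ln (1 - R s))"
      using R01[OF s] by (auto simp: mult_le_0_iff)
    moreover have "- ((1 - R t) * ln (1 - R t)) \<le> R t"
    proof -
      have "- ln (1 - R t) = ln (1 / (1 - R t))" using R01[OF t] by (simp add: ln_div)
      also have "\<dots> \<le> 1 / (1 - R t) - 1" using R01[OF t] by (intro ln_le_minus_one) auto
      finally have "(1 - R t) * - ln (1 - R t) \<le> (1 - R t) * (1 / (1 - R t) - 1)"
        using R01[OF t] by (intro mult_left_mono) auto
      also have "\<dots> = R t" using R01[OF t] by (simp add: field_simps)
      finally show ?thesis by simp
    qed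
    moreover have "R t * ln (R t) \<le> 0"
      using R01[OF t] by (auto simp: mult_le_0_iff)
    ultimately show ?thesis
      using mono[OF st] unfolding l_def u_def \<Phi>_def by (simp add: algebra_simps)
  qed
  define c where "c = (a + T) / 2"
  have c: "a < c" "c < T" using aT by (auto simp: c_def)
  have Rnz: "R x \<noteq> 0" if "a \<le> x" "x \<le> c" for x
    using Ra R01(1)[of x] that c by (cases "x = a") auto
  have contl: "continuous_on {a..c} l"
    unfolding l_def using c Rnz \<kappa>
    by (intro continuous_intros continuous_on_subset[OF contR] continuous_on_subset[OF contE]
         continuous_on_subset[OF cont\<psi>]) auto
  have contu: "continuous_on {a..T} u"
    unfolding u_def using \<kappa> by (intro continuous_intros contR contE cont\<psi>) auto
  have "l a \<le> u t" if t: "c \<le> t" "t < T" for t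
  proof (rule tendsto_upperbound)
    show "(l \<longlongrightarrow> l a) (at a within {a..c})"
      using contl c by (auto simp: continuous_on)
    show "\<forall>\<^sub>F s in at a within {a..c}. l s \<le> u t"
      unfolding eventually_at_filter by (rule always_eventually) (use lu t in auto)
    show "at a within {a..c} \<noteq> bot" using c by (simp add: at_within_Icc_at_right)
  qed
  note la = this
  have "l a \<le> u T"
  proof (rule tendsto_lowerbound)
    show "(u \<longlongrightarrow> u T) (at T within {c..T})"
      using continuous_on_subset[OF contu, of "{c..T}"] c by (auto simp: continuous_on)
    show "\<forall>\<^sub>F s in at T within {c..T}. l a \<le> u s"
      unfolding eventually_at_filter by (rule always_eventually) (use la in auto)
    show "at T within {c..T} \<noteq> bot" using c by (simp add: at_within_Icc_at_left)
  qed
  then have "L \<le> 1 + \<psi> a - \<kappa> * a + (E T - E a) / (4 * \<kappa>)"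
    by (simp add: l_def u_def Ra RT diff_divide_distrib)
  moreover have "exp L = \<kappa> * Z" using \<kappa> Zpos by (simp add: L_def exp_add)
  ultimately show ?thesis
    using exp_le_cancel_iff[of L] unfolding Z_def f_def by (metis)
qed

section \<open>The Moser integral of a concentrating pair\<close>

lemma nn_integral_atLeast_le:
  fixes f :: "real \<Rightarrow> ennreal"
  assumes f: "(\<lambda>t. f t * indicator {a..} t) \<in> borel_measurable lborel"
    and le: "\<And>T. a < T \<Longrightarrow> (\<integral>\<^sup>+t\<in>{a..T}. f t \<partial>lborel) \<le> C"
  shows "(\<integral>\<^sup>+t\<in>{a..}. f t \<partial>lborel) \<le> C"
proof -
  have *: "f t * indicator {a..} t * indicator {a..T} t = f t * indicator {a..T} t" for t T
    by (auto simp: indicator_def)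
  have "(\<integral>\<^sup>+t. (SUP n. f t * indicator {a..} t * indicator {a..a + 1 + real n} t) \<partial>lborel)
      = (SUP n. \<integral>\<^sup>+t. f t * indicator {a..} t * indicator {a..a + 1 + real n} t \<partial>lborel)"
    by (rule nn_integral_monotone_convergence_SUP)
       (use f in \<open>auto simp: incseq_def le_fun_def indicator_def\<close>)
  also have "\<dots> \<le> C"
    unfolding * by (intro SUP_least le) auto
  also have "(\<lambda>t. SUP n. f t * indicator {a..} t * indicator {a..a + 1 + real n} t)
      = (\<lambda>t. f t * indicator {a..} t)"
  proof
    fix t
    obtain n :: nat where n: "t - a - 1 \<le> real n" using real_arch_simple by blast
    show "(SUP n. f t * indicator {a..} t * indicator {a..a + 1 + real n} t) = f t * indicator {a..} t"
    proof (rule antisym)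
      show "(SUP n. f t * indicator {a..} t * indicator {a..a + 1 + real n} t) \<le> f t * indicator {a..} t"
        by (intro SUP_least) (auto simp: indicator_def)
      show "f t * indicator {a..} t \<le> (SUP n. f t * indicator {a..} t * indicator {a..a + 1 + real n} t)"
        by (rule SUP_upper2[of n]) (use n in \<open>auto simp: indicator_def\<close>)
    qed
  qed
  finally show ?thesis .
qed

lemma nn_integral_Icc_eq_integral:
  fixes f :: "real \<Rightarrow> real"
  assumes "continuous_on {a..b} f" "\<And>t. a \<le> t \<Longrightarrow> t \<le> b \<Longrightarrow> 0 \<le> f t"
  shows "(\<integral>\<^sup>+t\<in>{a..b}. ennreal (f t) \<partial>lborel) = ennreal (integral {a..b} f)"
proof -
  have 1: "set_integrable lborel {a..b} f"
    unfolding set_integrable_def using borel_integrable_atLeastAtMost'[OF assms(1)]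
    by (simp add: set_integrable_def)
  have "(\<integral>\<^sup>+t\<in>{a..b}. ennreal (f t) \<partial>lborel)
      = (\<integral>\<^sup>+t. ennreal (indicator {a..b} t *\<^sub>R f t) \<partial>lborel)"
    by (intro nn_integral_cong) (auto simp: indicator_def)
  also have "\<dots> = ennreal (LINT t:{a..b}|lborel. f t)"
    unfolding set_lebesgue_integral_def
    by (rule nn_integral_eq_integral)
       (use 1 assms(2) in \<open>auto simp: set_integrable_def indicator_def\<close>)
  also have "(LINT t:{a..b}|lborel. f t) = integral {a..b} f"
    by (rule set_borel_integral_eq_integral(2)[OF 1])
  finally show ?thesis .
qed

lemma two_ln_less:
  fixes x :: real
  assumes "0 < x"
  shows "2 * ln x < x"
proof -
  have "ln (x / 2) \<le> x / 2 - 1" using assms by (intro ln_le_minus_one) auto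
  then have "ln x \<le> x / 2 - 1 + ln 2" using assms by (simp add: ln_div)
  then show ?thesis using ln_2_less_1 by simp
qed

text \<open>Here \<open>E\<close> plays the role of the energy consumed up to time \<open>t\<close>, and \<open>\<kappa> = E a\<close> that of the part
  consumed before \<open>a\<close>. Expanding \<open>y\<^sup>2\<close> around \<open>y a\<close>, the quadratic remainder is at most
  \<open>(1 - \<kappa>) * (t - a)\<close>, which lowers the decay rate from 1 to \<open>\<kappa>\<close>; the linear part \<open>2 * y a * y\<close> is
  left to the sharp exponential inequality. The exponents then cancel exactly because
  \<open>(y a)\<^sup>2 \<le> a * \<kappa>\<close>.\<close>
lemma nn_integral_after_crossing_le:
  fixes y E :: "real \<Rightarrow> real"
  assumes a: "0 < a" and ya: "0 < y a"
    and mono_y: "mono_on {0..} y" and mono_E: "mono_on {0..} E"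
    and E1: "\<And>t. 0 \<le> t \<Longrightarrow> E t \<le> 1"
    and yE: "(y a)\<^sup>2 \<le> a * E a"
    and dy: "\<And>t. 0 < t \<Longrightarrow> 0 < y t \<Longrightarrow> (y has_real_derivative y' t) (at t)"
    and dE: "\<And>t. 0 < t \<Longrightarrow> 0 < y t \<Longrightarrow> (E has_real_derivative E' t) (at t)"
    and le: "\<And>t. 0 < t \<Longrightarrow> 0 < y t \<Longrightarrow> (y' t)\<^sup>2 \<le> E' t"
  shows "(\<integral>\<^sup>+t\<in>{a..}. ennreal (exp ((y t)\<^sup>2 - t)) \<partial>lborel) \<le> ennreal (exp 1 / E a)"
proof -
  define \<kappa> where "\<kappa> = E a"
  define D where "D = 1 - \<kappa>"
  define \<psi> where "\<psi> t = (y a)\<^sup>2 - D * a + 2 * y a * (y t - y a)" for t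
  have "0 < a * \<kappa>" using yE ya unfolding \<kappa>_def by (smt (verit) zero_less_power)
  then have \<kappa>: "0 < \<kappa>" using a by (simp add: zero_less_mult_iff)
  have ypos: "0 < y t" if "a \<le> t" for t
    using mono_onD[OF mono_y, of a t] that a ya by auto
  have pw: "(y t)\<^sup>2 - t \<le> \<psi> t - \<kappa> * t" if t: "a \<le> t" for t
  proof (cases "t = a")
    case True
    then show ?thesis by (simp add: \<psi>_def D_def algebra_simps)
  next
    case False
    have "(y t - y a)\<^sup>2 \<le> (t - a) * (E t - E a)"
    proof (rule square_increment_le[where \<tau>="\<lambda>t. t" and \<tau>'="\<lambda>_. 1" and V'=y' and E'=E'])
      fix s assume s: "a \<le> s" "s \<le> t"
      then show "0 \<le> E' s" using le[of s] ypos[of s] a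
        by (smt (verit) zero_le_power2)
      show "(y' s)\<^sup>2 \<le> 1 * E' s" using le[of s] ypos[of s] a s by simp
    qed (use False t a ypos dy dE in auto)
    also have "\<dots> \<le> (t - a) * D"
      using E1[of t] t a by (intro mult_left_mono) (auto simp: D_def \<kappa>_def)
    finally have "(y t - y a)\<^sup>2 \<le> (t - a) * D" .
    then show ?thesis
      by (simp add: \<psi>_def D_def algebra_simps power2_eq_square)
  qed
  show ?thesis
  proof (rule nn_integral_atLeast_le)
    have "continuous_on {a..} y"
      by (rule continuous_at_imp_continuous_on) (use dy[THEN DERIV_isCont] ypos a in \<open>auto simp: less_le_trans\<close>)
    then have "continuous_on {a..} (\<lambda>t. exp ((y t)\<^sup>2 - t))"
      by (intro continuous_intros)
    then have "(\<lambda>t. indicator {a..} t *\<^sub>R exp ((y t)\<^sup>2 - t)) \<in> borel_measurable borel"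
      by (intro borel_measurable_continuous_on_indicator) auto
    then have "(\<lambda>t. ennreal (indicator {a..} t *\<^sub>R exp ((y t)\<^sup>2 - t))) \<in> borel_measurable lborel"
      by simp
    then show "(\<lambda>t. ennreal (exp ((y t)\<^sup>2 - t)) * indicator {a..} t) \<in> borel_measurable lborel"
      by (rule measurable_cong[THEN iffD1, rotated]) (auto simp: indicator_def)
  next
    fix T assume T: "a < T"
    have d\<psi>: "(\<psi> has_real_derivative 2 * y a * y' t) (at t)" if "a \<le> t" for t
      unfolding \<psi>_def using dy[of t] ypos[OF that] a that
      by (auto intro!: derivative_eq_intros)
    have cont: "continuous_on {a..T} (\<lambda>t. exp (\<psi> t - \<kappa> * t))"
      by (intro continuous_intros continuous_at_imp_continuous_on) (use d\<psi> DERIV_isCont in fastforce)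
    have "\<kappa> * integral {a..T} (\<lambda>t. exp (\<psi> t - \<kappa> * t))
        \<le> exp (1 + \<psi> a - \<kappa> * a + (4 * (y a)\<^sup>2 * E T - 4 * (y a)\<^sup>2 * E a) / (4 * \<kappa>))"
    proof (rule onofri_interval[OF T \<kappa> d\<psi>, where E'="\<lambda>t. 4 * (y a)\<^sup>2 * E' t"])
      fix t assume t: "a \<le> t"
      show "((\<lambda>t. 4 * (y a)\<^sup>2 * E t) has_real_derivative 4 * (y a)\<^sup>2 * E' t) (at t)"
        using dE[of t] ypos[OF t] a t by (intro DERIV_cmult) auto
      show "(2 * y a * y' t)\<^sup>2 \<le> 4 * (y a)\<^sup>2 * E' t"
        using le[of t] ypos[OF t] a t by (simp add: power_mult_distrib mult_left_mono)
    qed auto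
    also have "\<dots> \<le> exp 1"
    proof -
      have "(4 * (y a)\<^sup>2 * E T - 4 * (y a)\<^sup>2 * E a) / (4 * \<kappa>) = (y a)\<^sup>2 * (E T - \<kappa>) / \<kappa>"
        using \<kappa> by (simp add: field_simps \<kappa>_def)
      also have "\<dots> \<le> (y a)\<^sup>2 * (1 - \<kappa>) / \<kappa>"
        using E1[of T] a T \<kappa> by (intro divide_right_mono mult_left_mono) auto
      also have "\<dots> = (y a)\<^sup>2 / \<kappa> - (y a)\<^sup>2" using \<kappa> by (simp add: field_simps)
      also have "(y a)\<^sup>2 / \<kappa> \<le> a" using yE \<kappa> by (simp add: \<kappa>_def field_simps)
      finally have "(4 * (y a)\<^sup>2 * E T - 4 * (y a)\<^sup>2 * E a) / (4 * \<kappa>) \<le> a - (y a)\<^sup>2" by simp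
      then show ?thesis
        by (simp add: \<psi>_def D_def algebra_simps)
    qed
    finally have *: "integral {a..T} (\<lambda>t. exp (\<psi> t - \<kappa> * t)) \<le> exp 1 / \<kappa>"
      using \<kappa> by (simp add: field_simps)
    have "(\<integral>\<^sup>+t\<in>{a..T}. ennreal (exp ((y t)\<^sup>2 - t)) \<partial>lborel)
        \<le> (\<integral>\<^sup>+t\<in>{a..T}. ennreal (exp (\<psi> t - \<kappa> * t)) \<partial>lborel)"
      by (intro nn_integral_mono) (auto simp: indicator_def pw)
    also have "\<dots> = ennreal (integral {a..T} (\<lambda>t. exp (\<psi> t - \<kappa> * t)))"
      by (rule nn_integral_Icc_eq_integral[OF cont]) auto
    also have "\<dots> \<le> ennreal (exp 1 / E a)"
      using * by (simp add: \<kappa>_def ennreal_leI)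
    finally show "(\<integral>\<^sup>+t\<in>{a..T}. ennreal (exp ((y t)\<^sup>2 - t)) \<partial>lborel) \<le> ennreal (exp 1 / E a)" .
  qed
qed

text \<open>The argument of Carleson and Chang. Up to \<open>A\<close> little energy is available, so \<open>y\<^sup>2\<close> is at most
  \<open>A * E A\<close> and the integral is close to 1. After \<open>A\<close> the integrand is below
  \<open>1 / t\<^sup>2\<close> until the first time \<open>a\<close> at which \<open>y\<^sup>2\<close> reaches \<open>t - 2 * ln t\<close>. At such a time nearly all
  energy has been used, \<open>E a \<ge> 1 - 2 * ln a / a\<close>, and what follows contributes at most
  \<open>exp 1 / E a\<close>.\<close>
lemma concentrated_moser_bound:
  fixes y E :: "real \<Rightarrow> real"
  assumes A: "3 \<le> A" and EA: "E A < 1 - 2 * ln A / A"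
    and y0: "\<And>t. 0 \<le> t \<Longrightarrow> 0 \<le> y t"
    and cont_y: "continuous_on {0..} y"
    and mono_y: "mono_on {0..} y" and mono_E: "mono_on {0..} E"
    and E1: "\<And>t. 0 \<le> t \<Longrightarrow> E t \<le> 1"
    and yE: "\<And>t. 0 \<le> t \<Longrightarrow> (y t)\<^sup>2 \<le> t * E t"
    and dy: "\<And>t. 0 < t \<Longrightarrow> 0 < y t \<Longrightarrow> (y has_real_derivative y' t) (at t)"
    and dE: "\<And>t. 0 < t \<Longrightarrow> 0 < y t \<Longrightarrow> (E has_real_derivative E' t) (at t)"
    and le: "\<And>t. 0 < t \<Longrightarrow> 0 < y t \<Longrightarrow> (y' t)\<^sup>2 \<le> E' t"
  shows "(\<integral>\<^sup>+t\<in>{0..}. ennreal (exp ((y t)\<^sup>2 - t)) \<partial>lborel)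
      \<le> ennreal (exp (A * E A) + 1 / A + exp 1 / (1 - 2 * ln A / A))"
proof -
  define g where "g t = ennreal (exp ((y t)\<^sup>2 - t))" for t
  define S where "S = {t \<in> {A..}. t - 2 * ln t \<le> (y t)\<^sup>2}"
  define q where "q = 1 - 2 * ln A / A"
  have q: "0 < q" using two_ln_less[of A] A by (simp add: q_def field_simps)
  have meas: "(\<lambda>t. g t * indicator {a..} t) \<in> borel_measurable lborel" if "0 \<le> a" for a
  proof -
    have "continuous_on {a..} (\<lambda>t. exp ((y t)\<^sup>2 - t))"
      using that by (intro continuous_intros continuous_on_subset[OF cont_y]) auto
    then have "(\<lambda>t. indicator {a..} t *\<^sub>R exp ((y t)\<^sup>2 - t)) \<in> borel_measurable borel"
      by (intro borel_measurable_continuous_on_indicator) auto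
    then have "(\<lambda>t. ennreal (indicator {a..} t *\<^sub>R exp ((y t)\<^sup>2 - t))) \<in> borel_measurable lborel"
      by simp
    then show ?thesis
      unfolding g_def by (rule measurable_cong[THEN iffD1, rotated]) (auto simp: indicator_def)
  qed
  have before: "(\<integral>\<^sup>+t\<in>{0..}. ennreal (exp (A * E A) * exp (- t)) \<partial>lborel) = ennreal (exp (A * E A))"
  proof -
    have "(\<integral>\<^sup>+t\<in>{0..}. ennreal (exp (A * E A) * exp (- t)) \<partial>lborel)
        = ennreal (0 - (- exp (A * E A) * exp (- 0)))"
      by (rule nn_integral_FTC_atLeast) (auto intro!: derivative_eq_intros, real_asymp)
    then show ?thesis by simp
  qed
  have middle: "(\<integral>\<^sup>+t\<in>{A..}. ennreal (1 / t\<^sup>2) \<partial>lborel) = ennreal (1 / A)"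
  proof -
    have "(\<integral>\<^sup>+t\<in>{A..}. ennreal (1 / t\<^sup>2) \<partial>lborel) = ennreal (0 - (- (1 / A)))"
      by (rule nn_integral_FTC_atLeast)
         (use A in \<open>auto intro!: derivative_eq_intros simp: power2_eq_square field_simps\<close>, real_asymp)
    then show ?thesis by simp
  qed
  have start: "g t \<le> ennreal (exp (A * E A) * exp (- t))" if "0 \<le> t" "t \<le> A" for t
  proof -
    have "(y t)\<^sup>2 \<le> t * E t" using yE that by simp
    also have "\<dots> \<le> A * E A"
    proof -
      have "0 \<le> E A"
        using yE[of A] A zero_le_power2[of "y A"] by (smt (verit) mult_pos_neg)
      moreover have "E t \<le> E A" using mono_onD[OF mono_E, of t A] that A by auto
      ultimately show ?thesis using that by (smt (verit) mult_mono mult_left_mono mult_right_mono)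
    qed
    finally show ?thesis by (simp add: g_def exp_add[symmetric] ennreal_leI)
  qed
  have early: "g t \<le> ennreal (1 / t\<^sup>2)" if "A \<le> t" "t \<notin> S" for t
  proof -
    have "(y t)\<^sup>2 - t \<le> - 2 * ln t" using that by (simp add: S_def)
    then have "exp ((y t)\<^sup>2 - t) \<le> exp (- 2 * ln t)" by simp
    also have "exp (- 2 * ln t) = 1 / t\<^sup>2"
      using that A by (simp add: exp_minus exp_double inverse_eq_divide)
    finally show ?thesis by (simp add: g_def ennreal_leI)
  qed
  show ?thesis
  proof (cases "S = {}")
    case True
    have "(\<integral>\<^sup>+t\<in>{0..}. g t \<partial>lborel)
        \<le> (\<integral>\<^sup>+t. ennreal (exp (A * E A) * exp (- t)) * indicator {0..} t
              + ennreal (1 / t\<^sup>2) * indicator {A..} t \<partial>lborel)"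
    proof (rule nn_integral_mono)
      fix t :: real
      show "g t * indicator {0..} t \<le> ennreal (exp (A * E A) * exp (- t)) * indicator {0..} t
              + ennreal (1 / t\<^sup>2) * indicator {A..} t"
        using start[of t] early[of t] True A by (cases "t \<le> A") (auto simp: indicator_def intro: add_increasing add_increasing2)
    qed
    also have "\<dots> = ennreal (exp (A * E A)) + ennreal (1 / A)"
      by (subst nn_integral_add) (simp_all add: before middle)
    also have "\<dots> \<le> ennreal (exp (A * E A) + 1 / A + exp 1 / q)"
      using A q by (simp add: ennreal_plus[symmetric] del: ennreal_plus)
    finally show ?thesis by (simp add: g_def q_def)
  next
    case False
    define a where "a = Inf S"
    have "closed S"
    proof -
      have "closed {t \<in> {A..}. t - 2 * ln t \<le> (y t)\<^sup>2}"
        using A by (intro continuous_on_closed_Collect_le continuous_intros continuous_on_subset[OF cont_y]) auto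
      then show ?thesis by (simp add: S_def)
    qed
    moreover have bdd: "bdd_below S" by (auto simp: S_def intro!: bdd_belowI[of _ A])
    ultimately have aS: "a \<in> S" using False closed_contains_Inf by (simp add: a_def)
    then have aA: "A \<le> a" and ya: "a - 2 * ln a \<le> (y a)\<^sup>2" by (auto simp: S_def)
    have nS: "t \<notin> S" if "t < a" for t using that bdd cInf_lower[of t S] by (auto simp: a_def)
    have a0: "0 < a" using aA A by simp
    have "0 < (y a)\<^sup>2" using ya two_ln_less[OF a0] by linarith
    then have ya0: "0 < y a" using y0[of a] a0 by (cases "y a = 0") auto
    have "(\<integral>\<^sup>+t\<in>{a..}. g t \<partial>lborel) \<le> ennreal (exp 1 / E a)"
      unfolding g_def
      by (rule nn_integral_after_crossing_le[where y'=y' and E'=E'])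
         (use a0 ya0 mono_y mono_E E1 yE dy dE le in auto)
    also have "\<dots> \<le> ennreal (exp 1 / q)"
    proof -
      have "a - 2 * ln a \<le> a * E a" using ya yE[of a] a0 by simp
      then have "1 - 2 * (ln a / a) \<le> E a" using a0 by (simp add: field_simps)
      moreover have "ln a / a \<le> ln A / A"
        using aA A exp_le by (intro ln_x_over_x_mono) auto
      ultimately have "q \<le> E a" by (simp add: q_def)
      then show ?thesis using q by (intro ennreal_leI divide_left_mono) auto
    qed
    finally have after: "(\<integral>\<^sup>+t\<in>{a..}. g t \<partial>lborel) \<le> ennreal (exp 1 / q)" .
    have "(\<integral>\<^sup>+t\<in>{0..}. g t \<partial>lborel)
        \<le> (\<integral>\<^sup>+t. (ennreal (exp (A * E A) * exp (- t)) * indicator {0..} t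
              + ennreal (1 / t\<^sup>2) * indicator {A..} t) + g t * indicator {a..} t \<partial>lborel)"
    proof (rule nn_integral_mono)
      fix t :: real
      show "g t * indicator {0..} t \<le> (ennreal (exp (A * E A) * exp (- t)) * indicator {0..} t
              + ennreal (1 / t\<^sup>2) * indicator {A..} t) + g t * indicator {a..} t"
      proof (cases "t < a")
        case True
        then show ?thesis
          using start[of t] early[of t] nS[of t] A
          by (cases "t \<le> A") (auto simp: indicator_def intro: add_increasing add_increasing2)
      next
        case False
        then show ?thesis using a0 by (auto simp: indicator_def intro: add_increasing)
      qed
    qed
    also have "\<dots> = (ennreal (exp (A * E A)) + ennreal (1 / A)) + (\<integral>\<^sup>+t\<in>{a..}. g t \<partial>lborel)"
      using meas[of a] a0 by (subst nn_integral_add; simp add: nn_integral_add before middle)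
    also have "\<dots> \<le> (ennreal (exp (A * E A)) + ennreal (1 / A)) + ennreal (exp 1 / q)"
      by (intro add_left_mono after)
    also have "\<dots> = ennreal (exp (A * E A) + 1 / A + exp 1 / q)"
      using A q by simp
    finally show ?thesis by (simp add: g_def q_def)
  qed
qed

lemma concentrated_moser_parameters:
  fixes \<epsilon> :: real
  assumes "0 < \<epsilon>"
  obtains A \<eta> where "3 \<le> A" "0 < \<eta>" "\<eta> < 1 - 2 * ln A / A"
    "exp (A * \<eta>) + 1 / A + exp 1 / (1 - 2 * ln A / A) \<le> 1 + exp 1 + \<epsilon>"
proof -
  have "((\<lambda>A. 1 / A + exp 1 / (1 - 2 * ln A / A)) \<longlongrightarrow> exp 1) (at_top :: real filter)"
    by real_asymp
  then have "\<forall>\<^sub>F A in at_top. 1 / A + exp 1 / (1 - 2 * ln A / A) < exp 1 + \<epsilon> / 2"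
    using assms by (intro order_tendstoD) auto
  then have "\<forall>\<^sub>F A in at_top. 3 \<le> A \<and> 1 / A + exp 1 / (1 - 2 * ln A / A) < exp 1 + \<epsilon> / 2"
    using eventually_ge_at_top[of "3 :: real"] by eventually_elim simp
  then obtain A :: real where A: "3 \<le> A" "1 / A + exp 1 / (1 - 2 * ln A / A) < exp 1 + \<epsilon> / 2"
    by (auto simp: eventually_at_top_linorder)
  define q where "q = 1 - 2 * ln A / A"
  have q: "0 < q" using two_ln_less[of A] A by (simp add: q_def field_simps)
  define \<eta> where "\<eta> = min (q / 2) (ln (1 + \<epsilon> / 2) / A)"
  have "0 < \<eta>" "\<eta> < q" using q assms A by (auto simp: \<eta>_def)
  moreover have "exp (A * \<eta>) \<le> 1 + \<epsilon> / 2"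
  proof -
    have "A * \<eta> \<le> A * (ln (1 + \<epsilon> / 2) / A)"
      using A by (intro mult_left_mono) (auto simp: \<eta>_def)
    also have "\<dots> = ln (1 + \<epsilon> / 2)" using A by simp
    finally show ?thesis using assms exp_le_cancel_iff[of "A * \<eta>" "ln (1 + \<epsilon> / 2)"] by simp
  qed
  ultimately show ?thesis using A by (intro that[of A \<eta>]) (auto simp: q_def)
qed

section \<open>Removing the weight\<close>

lemma DERIV_indefinite_integral:
  fixes f :: "real \<Rightarrow> real"
  assumes "continuous_on UNIV f" "a < t"
  shows "((\<lambda>t. integral {a..t} f) has_real_derivative f t) (at t)"
proof -
  have "((\<lambda>t. integral {a..t} f) has_real_derivative f t) (at t within {a..t + 1})"
    using assms by (intro integral_has_real_derivative continuous_on_subset[OF assms(1)]) auto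
  then show ?thesis
    using assms at_within_Icc_at[of a t "t + 1"] by simp
qed

lemma continuous_indefinite_integral:
  fixes f :: "real \<Rightarrow> real"
  assumes "continuous_on UNIV f"
  shows "continuous_on {a..} (\<lambda>t. integral {a..t} f)"
proof -
  have "continuous_on {a..} (\<lambda>t. integral {a - 1..t} f - integral {a - 1..a} f)"
  proof (intro continuous_at_imp_continuous_on ballI)
    fix t assume "t \<in> {a..}"
    then have "isCont (\<lambda>t. integral {a - 1..t} f) t"
      by (intro DERIV_isCont[OF DERIV_indefinite_integral] assms) auto
    then show "isCont (\<lambda>t. integral {a - 1..t} f - integral {a - 1..a} f) t"
      by (intro continuous_intros)
  qed
  moreover have "integral {a - 1..t} f - integral {a - 1..a} f = integral {a..t} f" if "t \<in> {a..}" for t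
  proof -
    have "integral {a - 1..a} f + integral {a..t} f = integral {a - 1..t} f"
      using that by (intro Henstock_Kurzweil_Integration.integral_combine
          integrable_continuous_interval continuous_on_subset[OF assms]) auto
    then show ?thesis by simp
  qed
  ultimately show ?thesis by (simp cong: continuous_on_cong_simp)
qed

text \<open>Radial profiles in the variable \<open>t = - 2 * ln r\<close>. With \<open>\<gamma> = 1 / (1 - \<beta>)\<close>, the variation \<open>V\<close>
  of the profile, normalised by \<open>C\<close>, dominates \<open>C * \<bar>H\<bar>\<close> and satisfies \<open>V\<^sup>2 \<le> (t / 2) powr (1 - \<beta>) * F\<close>,
  where \<open>F\<close> is the weighted energy used up to \<open>t\<close>. The pair \<open>y = sqrt 2 * V powr \<gamma>\<close>,
  \<open>E = F powr \<gamma>\<close> is then one for the unweighted problem: in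
  \<open>y'\<^sup>2 = 2 * \<gamma>\<^sup>2 * V powr (2 * \<gamma> - 2) * V'\<^sup>2\<close> the bound for \<open>V\<^sup>2\<close> produces \<open>F powr (\<gamma> - 1)\<close> and the factor
  \<open>(t / 2) powr \<beta>\<close>, that is, exactly the derivative of \<open>E\<close>. Keeping the factor
  \<open>F powr (\<gamma> - 1)\<close>, instead of bounding it by 1, is what avoids the loss of a factor \<open>\<gamma>\<close>.\<close>
lemma weighted_moser_bound:
  fixes H H' :: "real \<Rightarrow> real" and \<beta> :: real
  assumes \<beta>: "0 \<le> \<beta>" "\<beta> < 1" and t0: "0 < t0"
    and dH: "\<And>t. (H has_real_derivative H' t) (at t)" and contH': "continuous_on UNIV H'"
    and H0: "\<And>t. t \<le> t0 \<Longrightarrow> H t = 0" and H'0: "\<And>t. t \<le> t0 \<Longrightarrow> H' t = 0"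
    and energy: "(\<integral>\<^sup>+t\<in>{0..}. ennreal (4 * pi * (H' t)\<^sup>2 * (t / 2) powr \<beta>) \<partial>lborel) \<le> 1"
    and energyA: "(\<integral>\<^sup>+t\<in>{0..A}. ennreal (4 * pi * (H' t)\<^sup>2 * (t / 2) powr \<beta>) \<partial>lborel) \<le> ennreal \<eta>"
    and A: "3 \<le> A" and \<eta>: "0 < \<eta>" "\<eta> < 1 - 2 * ln A / A"
  shows "(\<integral>\<^sup>+t\<in>{0..}. ennreal (exp (alpha \<beta> * \<bar>H t\<bar> powr (2 / (1 - \<beta>)) - t)) \<partial>lborel)
      \<le> ennreal (exp (A * \<eta>) + 1 / A + exp 1 / (1 - 2 * ln A / A))"
proof -
  define \<gamma> where "\<gamma> = 1 / (1 - \<beta>)"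
  define C where "C = sqrt (2 * pi * (1 - \<beta>))"
  \<comment> \<open>Below \<open>t0\<close>, where \<open>H'\<close> vanishes, the weight is replaced by a constant. This keeps the base of
      \<open>powr\<close> away from 0 and does not change \<open>e\<close>.\<close>
  define \<omega> where "\<omega> t = (max t t0 / 2) powr \<beta>" for t
  define e where "e t = 4 * pi * (H' t)\<^sup>2 * \<omega> t" for t
  define V where "V t = C * integral {0..t} (\<lambda>s. \<bar>H' s\<bar>)" for t
  define F where "F t = integral {0..t} e" for t
  define \<tau> where "\<tau> t = (t / 2) powr (1 - \<beta>)" for t
  define y where "y t = sqrt 2 * V t powr \<gamma>" for t
  define E where "E t = F t powr \<gamma>" for t
  have \<gamma>: "1 \<le> \<gamma>" using \<beta> by (simp add: \<gamma>_def field_simps)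
  have C: "0 < C" "C\<^sup>2 = 2 * pi * (1 - \<beta>)" using \<beta> by (auto simp: C_def)
  have cont_abs: "continuous_on UNIV (\<lambda>s. \<bar>H' s\<bar>)" using contH' by (intro continuous_intros)
  have cont_e: "continuous_on UNIV e"
    unfolding e_def \<omega>_def using t0 contH' by (intro continuous_intros) auto
  have e_nonneg: "0 \<le> e t" for t by (simp add: e_def \<omega>_def)
  have e_eq: "e t = 4 * pi * (H' t)\<^sup>2 * (t / 2) powr \<beta>" for t
    using H'0[of t] by (cases "t \<le> t0") (auto simp: e_def \<omega>_def max_def)
  have int_abs: "(\<lambda>s. \<bar>H' s\<bar>) integrable_on {a..b}" for a b
    by (intro integrable_continuous_interval continuous_on_subset[OF cont_abs]) auto
  have int_e: "e integrable_on {a..b}" for a b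
    by (intro integrable_continuous_interval continuous_on_subset[OF cont_e]) auto
  have V0: "V t = 0" if "t \<le> t0" for t
  proof -
    have "integral {0..t} (\<lambda>s. \<bar>H' s\<bar>) = integral {0..t} (\<lambda>s. 0 :: real)"
      by (rule integral_cong) (use H'0 that in auto)
    then show ?thesis by (simp add: V_def)
  qed
  have F0: "F t = 0" if "t \<le> t0" for t
  proof -
    have "F t = integral {0..t} (\<lambda>s. 0 :: real)"
      unfolding F_def by (rule integral_cong) (use H'0 that in \<open>auto simp: e_def\<close>)
    then show ?thesis by simp
  qed
  have V_nonneg: "0 \<le> V t" for t
    unfolding V_def using C int_abs by (intro mult_nonneg_nonneg integral_nonneg) auto
  have F_nonneg: "0 \<le> F t" for t
    unfolding F_def using e_nonneg int_e by (intro integral_nonneg) auto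
  have V_mono: "V s \<le> V t" if "0 \<le> s" "s \<le> t" for s t
    unfolding V_def using C that
    by (intro mult_left_mono integral_subset_le int_abs) auto
  have F_mono: "F s \<le> F t" if "0 \<le> s" "s \<le> t" for s t
    unfolding F_def using that e_nonneg by (intro integral_subset_le int_e) auto
  have F_nn: "ennreal (F t) = (\<integral>\<^sup>+s\<in>{0..t}. ennreal (4 * pi * (H' s)\<^sup>2 * (s / 2) powr \<beta>) \<partial>lborel)" for t
    unfolding F_def
    by (subst nn_integral_Icc_eq_integral[symmetric])
       (auto simp: e_eq[symmetric] e_nonneg intro!: continuous_on_subset[OF cont_e])
  have F1: "F t \<le> 1" for t
  proof -
    have "ennreal (F t) \<le> (\<integral>\<^sup>+t\<in>{0..}. ennreal (4 * pi * (H' t)\<^sup>2 * (t / 2) powr \<beta>) \<partial>lborel)"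
      unfolding F_nn by (intro nn_integral_mono) (auto simp: indicator_def)
    also note energy
    finally show ?thesis by simp
  qed
  have FA: "F A \<le> \<eta>" using energyA \<eta> by (simp add: F_nn[symmetric])
  have dV: "(V has_real_derivative C * \<bar>H' t\<bar>) (at t)" if "0 < t" for t
    unfolding V_def using DERIV_indefinite_integral[OF cont_abs that] by (rule DERIV_cmult)
  have dF: "(F has_real_derivative e t) (at t)" if "0 < t" for t
    unfolding F_def using DERIV_indefinite_integral[OF cont_e that] .
  have V_le: "(V t)\<^sup>2 \<le> \<tau> t * F t" if "0 \<le> t" for t
  proof (cases "t \<le> t0")
    case True
    then show ?thesis using V0 F0 by simp
  next
    case False
    have "(V t - V t0)\<^sup>2 \<le> (\<tau> t - \<tau> t0) * (F t - F t0)"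
    proof (rule square_increment_le[where V'="\<lambda>t. C * \<bar>H' t\<bar>" and E'=e
          and \<tau>'="\<lambda>t. (1 - \<beta>) / 2 * (t / 2) powr (- \<beta>)"])
      show "\<tau> t0 < \<tau> t" unfolding \<tau>_def using False t0 \<beta> by (intro powr_less_mono2) auto
      fix s assume s: "t0 \<le> s" "s \<le> t"
      then have s0: "0 < s" using t0 by simp
      show "(\<tau> has_real_derivative (1 - \<beta>) / 2 * (s / 2) powr (- \<beta>)) (at s)"
        unfolding \<tau>_def using s0 by (intro DERIV_cong[OF DERIV_fun_powr[where m="1 / 2"]]) (auto intro!: derivative_eq_intros)
      show "0 \<le> (1 - \<beta>) / 2 * (s / 2) powr (- \<beta>)" using \<beta> by simp
      have "(s / 2) powr (- \<beta>) * (s / 2) powr \<beta> = 1" using s0 by (simp add: powr_add[symmetric])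
      then have "(1 - \<beta>) / 2 * (s / 2) powr (- \<beta>) * e s = 2 * pi * (1 - \<beta>) * (H' s)\<^sup>2"
        unfolding e_eq by (simp add: field_simps)
      then show "(C * \<bar>H' s\<bar>)\<^sup>2 \<le> (1 - \<beta>) / 2 * (s / 2) powr (- \<beta>) * e s"
        by (simp only: power_mult_distrib C power2_abs order_refl)
    qed (use False t0 dV dF e_nonneg in auto)
    also have "\<dots> \<le> \<tau> t * F t"
      using V0[of t0] F0[of t0] F_nonneg by (auto simp: \<tau>_def intro!: mult_right_mono)
    finally show ?thesis using V0[of t0] by simp
  qed
  have V_powr: "(V t)\<^sup>2 powr p \<le> (t / 2) powr ((1 - \<beta>) * p) * F t powr p" if "0 \<le> t" "0 \<le> p" for t p
  proof -
    have "(V t)\<^sup>2 powr p \<le> (\<tau> t * F t) powr p"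
      using V_le that by (intro powr_mono2) auto
    also have "\<dots> = (t / 2) powr ((1 - \<beta>) * p) * F t powr p"
      using F_nonneg that by (simp add: powr_mult \<tau>_def powr_powr)
    finally show ?thesis .
  qed
  have V2: "(V t)\<^sup>2 powr p = (V t powr p)\<^sup>2" for t p
    using V_nonneg[of t] by (simp add: power2_eq_square powr_mult)
  have V_pos: "t0 < t \<and> 0 < V t \<and> 0 < F t" if "0 < y t" "0 < t" for t
  proof -
    have V: "0 < V t" using that V_nonneg[of t] by (cases "V t = 0") (auto simp: y_def)
    moreover have "0 < F t"
      using V V_le[of t] that F_nonneg[of t] by (cases "F t = 0") auto
    moreover have "t0 < t" using V V0[of t] by (cases "t0 < t") auto
    ultimately show ?thesis by simp
  qed
  have y2: "(y t)\<^sup>2 = 2 * (V t)\<^sup>2 powr \<gamma>" for t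
    by (simp add: y_def power_mult_distrib V2)
  have "(\<integral>\<^sup>+t\<in>{0..}. ennreal (exp (alpha \<beta> * \<bar>H t\<bar> powr (2 / (1 - \<beta>)) - t)) \<partial>lborel)
      \<le> (\<integral>\<^sup>+t\<in>{0..}. ennreal (exp ((y t)\<^sup>2 - t)) \<partial>lborel)"
  proof (rule nn_integral_mono)
    fix t :: real
    have "alpha \<beta> * \<bar>H t\<bar> powr (2 / (1 - \<beta>)) \<le> (y t)\<^sup>2" if t: "0 \<le> t"
    proof -
      have "(H' has_integral (H t - H 0)) {0..t}"
        using t dH by (intro fundamental_theorem_of_calculus)
          (auto simp: has_real_derivative_iff_has_vector_derivative[symmetric] intro: has_field_derivative_at_within)
      then have "H t = integral {0..t} H'" using H0[of 0] t0 by (simp add: integral_unique)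
      moreover have "norm (integral {0..t} H') \<le> integral {0..t} (\<lambda>s. norm (H' s))"
        by (rule integral_norm_bound_integral[OF integrable_continuous_interval[OF continuous_on_subset[OF contH']]])
           (use int_abs in auto)
      ultimately have HV: "C * \<bar>H t\<bar> \<le> V t" using C by (simp add: V_def)
      have "alpha \<beta> * \<bar>H t\<bar> powr (2 / (1 - \<beta>)) = 2 * ((C\<^sup>2) powr \<gamma> * (\<bar>H t\<bar>\<^sup>2) powr \<gamma>)"
      proof -
        have g: "2 / (1 - \<beta>) = \<gamma> + \<gamma>" by (simp add: \<gamma>_def)
        have "(\<bar>H t\<bar>\<^sup>2) powr \<gamma> = \<bar>H t\<bar> powr (2 / (1 - \<beta>))"
          unfolding g by (simp only: power2_eq_square powr_mult powr_add)
        then show ?thesis unfolding C alpha_def by (simp only: \<gamma>_def mult.assoc)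
      qed
      also have "\<dots> = 2 * ((C * \<bar>H t\<bar>)\<^sup>2) powr \<gamma>"
        by (simp add: power_mult_distrib powr_mult)
      also have "\<dots> \<le> (y t)\<^sup>2"
        unfolding y2 using HV C \<gamma>
        by (intro mult_left_mono powr_mono2 power_mono) auto
      finally show ?thesis .
    qed
    then show "ennreal (exp (alpha \<beta> * \<bar>H t\<bar> powr (2 / (1 - \<beta>)) - t)) * indicator {0..} t
        \<le> ennreal (exp ((y t)\<^sup>2 - t)) * indicator {0..} t"
      by (auto simp: indicator_def intro!: ennreal_leI)
  qed
  also have "\<dots> \<le> ennreal (exp (A * E A) + 1 / A + exp 1 / (1 - 2 * ln A / A))"
  proof (rule concentrated_moser_bound[where
        y'="\<lambda>t. sqrt 2 * (\<gamma> * V t powr (\<gamma> - 1) * (C * \<bar>H' t\<bar>))" and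
        E'="\<lambda>t. \<gamma> * F t powr (\<gamma> - 1) * e t"])
    show "3 \<le> A" by fact
    have "E A \<le> F A powr 1"
      unfolding E_def using \<gamma> F1 F_nonneg by (intro powr_mono') auto
    then show "E A < 1 - 2 * ln A / A" using FA \<eta> F_nonneg[of A] by simp
    show "0 \<le> y t" for t by (simp add: y_def)
    have "continuous_on {0..} V"
      unfolding V_def by (intro continuous_intros continuous_indefinite_integral cont_abs)
    then show "continuous_on {0..} y"
      unfolding y_def using \<gamma> V_nonneg by (intro continuous_intros continuous_on_powr') auto
    show "mono_on {0..} y"
      unfolding y_def using \<gamma> V_nonneg V_mono
      by (intro mono_onI mult_left_mono powr_mono2) auto
    show "mono_on {0..} E"
      unfolding E_def using \<gamma> F_nonneg F_mono by (intro mono_onI powr_mono2) auto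
    show "E t \<le> 1" for t
      unfolding E_def using powr_mono2[of \<gamma> "F t" 1] \<gamma> F_nonneg F1 by simp
  next
    fix t :: real assume t: "0 \<le> t"
    have "(1 - \<beta>) * \<gamma> = 1" using \<beta> by (simp add: \<gamma>_def)
    then show "(y t)\<^sup>2 \<le> t * E t"
      using V_powr[OF t, of \<gamma>] \<gamma> t by (simp add: y2 E_def)
  next
    fix t :: real assume t: "0 < t" "0 < y t"
    note pos = V_pos[OF t(2,1)]
    show "(y has_real_derivative sqrt 2 * (\<gamma> * V t powr (\<gamma> - 1) * (C * \<bar>H' t\<bar>))) (at t)"
      unfolding y_def using pos dV[OF t(1)]
      by (intro DERIV_cmult DERIV_cong[OF DERIV_fun_powr]) auto
    show "(E has_real_derivative \<gamma> * F t powr (\<gamma> - 1) * e t) (at t)"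
      unfolding E_def using pos dF[OF t(1)] by (intro DERIV_cong[OF DERIV_fun_powr]) auto
    have g: "(1 - \<beta>) * (\<gamma> - 1) = \<beta>" using \<beta> by (simp add: \<gamma>_def field_simps)
    have "(sqrt 2 * (\<gamma> * V t powr (\<gamma> - 1) * (C * \<bar>H' t\<bar>)))\<^sup>2
        = 4 * pi * ((1 - \<beta>) * \<gamma>) * \<gamma> * (H' t)\<^sup>2 * (V t)\<^sup>2 powr (\<gamma> - 1)"
      by (simp add: power_mult_distrib C V2 power2_eq_square[of \<gamma>])
    also have "(1 - \<beta>) * \<gamma> = 1" using \<beta> by (simp add: \<gamma>_def)
    also have "4 * pi * 1 * \<gamma> * (H' t)\<^sup>2 * (V t)\<^sup>2 powr (\<gamma> - 1)
        \<le> 4 * pi * 1 * \<gamma> * (H' t)\<^sup>2 * ((t / 2) powr \<beta> * F t powr (\<gamma> - 1))"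
      using V_powr[of t "\<gamma> - 1"] t \<gamma> unfolding g by (intro mult_left_mono) auto
    also have "\<dots> = \<gamma> * F t powr (\<gamma> - 1) * e t" by (simp add: e_eq)
    finally show "(sqrt 2 * (\<gamma> * V t powr (\<gamma> - 1) * (C * \<bar>H' t\<bar>)))\<^sup>2 \<le> \<gamma> * F t powr (\<gamma> - 1) * e t" .
  qed
  also have "\<dots> \<le> ennreal (exp (A * \<eta>) + 1 / A + exp 1 / (1 - 2 * ln A / A))"
  proof -
    have "E A \<le> F A powr 1"
      unfolding E_def using \<gamma> F1 F_nonneg by (intro powr_mono') auto
    then have "E A \<le> \<eta>" using FA F_nonneg[of A] by simp
    then have "A * E A \<le> A * \<eta>" using A by (intro mult_left_mono) auto
    then show ?thesis by (intro ennreal_leI) simp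
  qed
  finally show ?thesis .
qed

section \<open>Radial integrals and rotations of the plane\<close>

text \<open>The image of Lebesgue measure on the disc under \<open>x \<mapsto> - 2 * ln (norm x)\<close> has density
  \<open>pi * exp (- t)\<close> on the half-line, since the set where the image exceeds \<open>a \<ge> 0\<close> is a punctured
  disc of radius \<open>exp (- a / 2)\<close>.\<close>
lemma nn_integral_disc_radial:
  fixes g :: "real \<Rightarrow> ennreal"
  assumes g[measurable]: "g \<in> borel_measurable borel"
  shows "(\<integral>\<^sup>+x\<in>unit_disc. g (- 2 * ln (norm x)) \<partial>lborel)
      = (\<integral>\<^sup>+t\<in>{0..}. ennreal (pi * exp (- t)) * g t \<partial>lborel)"
proof -
  have [measurable]: "(indicator unit_disc :: plane \<Rightarrow> ennreal) \<in> borel_measurable borel"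
    by (rule borel_measurable_indicator) simp
  define M where "M = distr (density lborel (indicator unit_disc)) borel (\<lambda>x::plane. - 2 * ln (norm x))"
  define N where "N = density lborel (\<lambda>t. ennreal (pi * exp (- t)) * indicator {0..} t)"
  have eM: "emeasure M {a<..} = ennreal (pi * exp (- max 0 a))" for a
  proof -
    have "emeasure M {a<..} = emeasure (density lborel (indicator unit_disc)) ((\<lambda>x::plane. - 2 * ln (norm x)) -` {a<..})"
      unfolding M_def by (subst emeasure_distr) auto
    also have "\<dots> = (\<integral>\<^sup>+x. indicator unit_disc x * indicator ((\<lambda>x::plane. - 2 * ln (norm x)) -` {a<..}) x \<partial>lborel)"
      by (rule emeasure_density) (auto intro!: measurable_sets_borel[OF _ greaterThan_borel])
    also have "\<dots> = (\<integral>\<^sup>+x. indicator (ball 0 (exp (- max 0 a / 2))) x \<partial>(lborel :: plane measure))"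
    proof (rule nn_integral_cong_AE)
      show "AE x::plane in lborel. indicator unit_disc x * indicator ((\<lambda>x::plane. - 2 * ln (norm x)) -` {a<..}) x
          = (indicator (ball 0 (exp (- max 0 a / 2))) x :: ennreal)"
        using AE_lborel_singleton[of "0::plane"]
      proof eventually_elim
        case (elim x)
        then have x: "0 < norm x" by simp
        have 1: "norm x < exp (- max 0 a / 2) \<longleftrightarrow> ln (norm x) < - max 0 a / 2"
          using x by (metis exp_gt_zero ln_exp ln_less_cancel_iff)
        have 2: "norm x < 1 \<longleftrightarrow> ln (norm x) < 0" using x by simp
        show ?case
          unfolding indicator_def using 1 2 by (auto simp: dist_norm max_def split: if_splits)
      qed
    qed
    also have "\<dots> = ennreal (pi * exp (- max 0 a))"
      by (simp add: emeasure_ball unit_ball_vol_2 power2_eq_square exp_add[symmetric])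
    finally show ?thesis .
  qed
  have eN: "emeasure N {a<..} = ennreal (pi * exp (- max 0 a))" for a
  proof -
    have "emeasure N {a<..} = (\<integral>\<^sup>+t. ennreal (pi * exp (- t)) * indicator {0..} t * indicator {a<..} t \<partial>lborel)"
      unfolding N_def by (rule emeasure_density) auto
    also have "\<dots> = (\<integral>\<^sup>+t. ennreal (pi * exp (- t)) * indicator {max 0 a..} t \<partial>lborel)"
    proof (rule nn_integral_cong_AE)
      show "AE t in lborel. ennreal (pi * exp (- t)) * indicator {0..} t * indicator {a<..} t
          = ennreal (pi * exp (- t)) * indicator {max 0 a..} t"
        using AE_lborel_singleton[of a]
        by eventually_elim (auto simp: indicator_def)
    qed
    also have "\<dots> = ennreal (0 - (- pi * exp (- max 0 a)))"
      by (rule nn_integral_FTC_atLeast) (auto intro!: derivative_eq_intros, real_asymp)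
    finally show ?thesis by simp
  qed
  have MN: "M = N"
    by (rule measure_eqI_lessThan) (auto simp: eM eN, auto simp: M_def N_def)
  have "(\<integral>\<^sup>+x\<in>unit_disc. g (- 2 * ln (norm x)) \<partial>lborel)
      = (\<integral>\<^sup>+x. indicator unit_disc x * g (- 2 * ln (norm x)) \<partial>lborel)"
    by (simp add: mult.commute)
  also have "\<dots> = (\<integral>\<^sup>+x. g (- 2 * ln (norm x)) \<partial>density lborel (indicator unit_disc))"
    by (subst nn_integral_density) auto
  also have "\<dots> = (\<integral>\<^sup>+t. g t \<partial>M)"
    unfolding M_def by (subst nn_integral_distr) auto
  also have "\<dots> = (\<integral>\<^sup>+t. ennreal (pi * exp (- t)) * indicator {0..} t * g t \<partial>lborel)"
    unfolding MN N_def by (subst nn_integral_density) auto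
  finally show ?thesis by (simp add: mult_ac)
qed

lemma distr_lborel_orthogonal_transformation:
  fixes f :: "(real^'n::{finite,wellorder}) \<Rightarrow> real^'n::_"
  assumes f: "orthogonal_transformation f"
  shows "distr lborel borel f = lborel"
proof (rule lborel_eqI[symmetric])
  have lin: "linear f" using f by (rule orthogonal_transformation_linear)
  have [measurable]: "f \<in> borel_measurable borel"
    using lin by (intro borel_measurable_continuous_onI linear_continuous_on) (simp add: linear_linear)
  fix l u :: "real^'n::_" assume lu: "\<And>b. b \<in> Basis \<Longrightarrow> l \<bullet> b \<le> u \<bullet> b"
  have "bij f" using f by (rule orthogonal_transformation_bij)
  then have vim: "f -` S = inv f ` S" for S by (rule bij_vimage_eq_inv_image)
  have g: "orthogonal_transformation (inv f)" using f by (rule orthogonal_transformation_inv)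
  have "emeasure (distr lborel borel f) (box l u) = emeasure lborel (f -` box l u)"
    by (subst emeasure_distr) auto
  also have "\<dots> = emeasure lebesgue (f -` box l u)"
    using measurable_sets_borel[of f borel "box l u"] by auto
  also have "\<dots> = ennreal (measure lebesgue (inv f ` box l u))"
    unfolding vim by (intro emeasure_eq_measure2 measurable_orthogonal_image[OF g lmeasurable_box])
  also have "\<dots> = ennreal (measure lebesgue (box l u))"
    using measure_orthogonal_image[OF g lmeasurable_box] by simp
  also have "\<dots> = emeasure lborel (box l u)"
    using emeasure_eq_measure2[OF lmeasurable_box[of l u]] by simp
  finally show "emeasure (distr lborel borel f) (box l u) = (\<Prod>b\<in>Basis. (u - l) \<bullet> b)"
    using lu by simp
qed simp

definition rot :: "real \<Rightarrow> plane \<Rightarrow> plane" where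
  "rot \<theta> x = (cos \<theta> * x $ 1 - sin \<theta> * x $ 2) *\<^sub>R axis 1 1 + (sin \<theta> * x $ 1 + cos \<theta> * x $ 2) *\<^sub>R axis 2 1"

definition polar :: "real \<Rightarrow> real \<Rightarrow> plane" where
  "polar r \<theta> = r *\<^sub>R (cos \<theta> *\<^sub>R axis 1 1 + sin \<theta> *\<^sub>R axis 2 1)"

lemma rot_nth [simp]:
  "rot \<theta> x $ 1 = cos \<theta> * x $ 1 - sin \<theta> * x $ 2"
  "rot \<theta> x $ 2 = sin \<theta> * x $ 1 + cos \<theta> * x $ 2"
  by (simp_all add: rot_def axis_def)

lemma polar_nth [simp]: "polar r \<theta> $ 1 = r * cos \<theta>" "polar r \<theta> $ 2 = r * sin \<theta>"
  by (simp_all add: polar_def axis_def)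

lemma norm_plane: "norm (x :: plane) = sqrt ((x $ 1)\<^sup>2 + (x $ 2)\<^sup>2)"
  by (simp add: norm_vec_def L2_set_def sum_2)

lemma norm_polar [simp]: "norm (polar r \<theta>) = \<bar>r\<bar>"
proof -
  have "(r * cos \<theta>)\<^sup>2 + (r * sin \<theta>)\<^sup>2 = r\<^sup>2 * ((cos \<theta>)\<^sup>2 + (sin \<theta>)\<^sup>2)"
    by (simp only: power_mult_distrib distrib_left)
  also have "\<dots> = r\<^sup>2" by (simp only: sin_cos_squared_add2 mult_1_right)
  finally show ?thesis by (simp add: norm_plane)
qed

lemma polar_exists: obtains \<theta> where "x = polar (norm x) \<theta>"
proof (cases "x = 0")
  case True
  then show ?thesis by (intro that[of 0]) (simp add: polar_def)
next
  case False
  have n: "(norm x)\<^sup>2 = (x $ 1)\<^sup>2 + (x $ 2)\<^sup>2" by (simp add: norm_plane)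
  have "(x $ 1 / norm x)\<^sup>2 + (x $ 2 / norm x)\<^sup>2 = (norm x)\<^sup>2 / (norm x)\<^sup>2"
    by (simp only: n power_divide add_divide_distrib[symmetric])
  also have "\<dots> = 1" using False by simp
  finally have "(x $ 1 / norm x)\<^sup>2 + (x $ 2 / norm x)\<^sup>2 = 1" .
  then obtain \<theta> where \<theta>: "x $ 1 / norm x = cos \<theta>" "x $ 2 / norm x = sin \<theta>"
    by (rule sincos_total_2pi)
  have "x $ 1 = polar (norm x) \<theta> $ 1" "x $ 2 = polar (norm x) \<theta> $ 2"
    using False by (simp_all flip: \<theta>)
  then have "x = polar (norm x) \<theta>"
    unfolding vec_eq_iff forall_2 by (rule conjI)
  then show ?thesis by (rule that)
qed

lemma rot_polar: "rot \<theta> (polar r \<eta>) = polar r (\<theta> + \<eta>)"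
  by (simp add: vec_eq_iff forall_2 cos_add sin_add algebra_simps)

lemma norm_rot [simp]: "norm (rot \<theta> x) = norm x"
proof -
  obtain \<eta> where "x = polar (norm x) \<eta>" by (rule polar_exists)
  then have "norm (rot \<theta> x) = norm (polar (norm x) (\<theta> + \<eta>))" by (metis rot_polar)
  then show ?thesis by simp
qed

lemma orthogonal_transformation_rot: "orthogonal_transformation (rot \<theta>)"
proof -
  have "linear (rot \<theta>)"
  proof (rule linearI)
    show "rot \<theta> (x + y) = rot \<theta> x + rot \<theta> y" for x y
      unfolding vec_eq_iff forall_2 by (simp add: distrib_left)
    show "rot \<theta> (c *\<^sub>R x) = c *\<^sub>R rot \<theta> x" for c x
      unfolding vec_eq_iff forall_2 by (simp add: right_diff_distrib distrib_left)
  qed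
  then show ?thesis by (simp add: orthogonal_transformation)
qed

lemma distr_lborel_rot: "distr lborel borel (rot \<theta>) = lborel"
  by (rule distr_lborel_orthogonal_transformation[OF orthogonal_transformation_rot])

lemma continuous_on_rot [continuous_intros]:
  fixes S :: "'a::t2_space set"
  shows "continuous_on S f \<Longrightarrow> continuous_on S g \<Longrightarrow> continuous_on S (\<lambda>x. rot (f x) (g x))"
  unfolding rot_def by (intro continuous_intros)

lemma continuous_on_polar [continuous_intros]:
  fixes S :: "'a::t2_space set"
  shows "continuous_on S f \<Longrightarrow> continuous_on S g \<Longrightarrow> continuous_on S (\<lambda>x. polar (f x) (g x))"
  unfolding polar_def by (intro continuous_intros)

lemma measurable_rot_compose [measurable (raw)]:
  assumes [measurable]: "f \<in> borel_measurable M" "g \<in> borel_measurable M"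
  shows "(\<lambda>x. rot (f x) (g x)) \<in> borel_measurable M"
proof -
  have [measurable]: "(\<lambda>p. rot (fst p) (snd p)) \<in> borel_measurable (borel \<Otimes>\<^sub>M borel)"
    unfolding borel_prod by (intro borel_measurable_continuous_onI continuous_intros)
  have "(\<lambda>x. (\<lambda>p. rot (fst p) (snd p)) (f x, g x)) \<in> borel_measurable M"
    by measurable
  then show ?thesis by simp
qed

lemma measurable_rot [measurable]: "rot \<theta> \<in> borel_measurable borel"
  by (intro borel_measurable_continuous_onI continuous_intros)

lemma nn_integral_rot:
  assumes [measurable]: "h \<in> borel_measurable borel"
  shows "(\<integral>\<^sup>+x. h (rot \<theta> x) \<partial>lborel) = (\<integral>\<^sup>+x. h x \<partial>lborel)"
proof -
  have "(\<integral>\<^sup>+x. h x \<partial>lborel) = (\<integral>\<^sup>+x. h x \<partial>distr lborel borel (rot \<theta>))"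
    by (subst distr_lborel_rot) (rule refl)
  also have "\<dots> = (\<integral>\<^sup>+x. h (rot \<theta> x) \<partial>lborel)"
    by (subst nn_integral_distr) auto
  finally show ?thesis by simp
qed

lemma AE_rot:
  assumes "AE x in lborel. P x"
  shows "AE x in lborel. P (rot \<theta> x)"
proof -
  have "AE x in distr lborel borel (rot \<theta>). P x" by (subst distr_lborel_rot) (rule assms)
  then show ?thesis by (rule AE_distrD[rotated]) auto
qed

lemma nn_integral_rot_average:
  assumes [measurable]: "h \<in> borel_measurable borel"
  shows "(\<integral>\<^sup>+x. (\<integral>\<^sup>+\<theta>\<in>{0..2 * pi}. h (rot \<theta> x) \<partial>lborel) \<partial>lborel)
      = ennreal (2 * pi) * (\<integral>\<^sup>+x. h x \<partial>lborel)"
proof -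
  have "(\<integral>\<^sup>+x. (\<integral>\<^sup>+\<theta>\<in>{0..2 * pi}. h (rot \<theta> x) \<partial>lborel) \<partial>lborel)
      = (\<integral>\<^sup>+\<theta>. (\<integral>\<^sup>+x. h (rot \<theta> x) * indicator {0..2 * pi} \<theta> \<partial>lborel) \<partial>lborel)"
    by (rule lborel_pair.Fubini') measurable
  also have "\<dots> = (\<integral>\<^sup>+\<theta>. (\<integral>\<^sup>+x. h x \<partial>lborel) * indicator {0..2 * pi} \<theta> \<partial>lborel)"
    by (subst nn_integral_multc) (auto simp: nn_integral_rot)
  also have "\<dots> = (\<integral>\<^sup>+x. h x \<partial>lborel) * ennreal (2 * pi)"
    by (subst nn_integral_cmult) auto
  finally show ?thesis by (simp add: mult.commute)
qed

text \<open>The integral of \<open>p\<close> over \<open>{s..s + c}\<close> has derivative \<open>p (s + c) - p s = 0\<close> in \<open>s\<close>.\<close>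
lemma integral_periodic_shift:
  fixes p :: "real \<Rightarrow> real"
  assumes cont: "continuous_on UNIV p" and per: "\<And>x. p (x + c) = p x" and c: "0 \<le> c"
  shows "integral {0..c} (\<lambda>x. p (x + \<eta>)) = integral {0..c} p"
proof -
  define a where "a = - \<bar>\<eta>\<bar> - 1"
  define I where "I s = integral {a..s + c} p - integral {a..s} p" for s
  have int: "p integrable_on {s..t}" for s t
    by (intro integrable_continuous_interval continuous_on_subset[OF cont]) auto
  have I: "I s = integral {s..s + c} p" if "a < s" for s
    using Henstock_Kurzweil_Integration.integral_combine[of a s "s + c" p] int that c by (simp add: I_def)
  have dI: "(I has_real_derivative 0) (at s)" if "a < s" for s
  proof -
    have "((\<lambda>s. integral {a..s + c} p) has_real_derivative p (s + c)) (at s)"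
      using DERIV_indefinite_integral[OF cont, of a "s + c"] that c
      by (subst DERIV_shift[symmetric, where f="\<lambda>s. integral {a..s} p"]) auto
    then show ?thesis
      unfolding I_def using DERIV_diff[OF _ DERIV_indefinite_integral[OF cont that]] per by force
  qed
  have "I 0 = I \<eta>"
  proof (cases "0 \<le> \<eta>")
    case True
    then show ?thesis
      using deriv_imp_increment_le[of 0 \<eta> I "\<lambda>_. 0" "\<lambda>_. 0" "\<lambda>_. 0"]
        deriv_imp_increment_le[of 0 \<eta> "\<lambda>_. 0" "\<lambda>_. 0" I "\<lambda>_. 0"] dI by (force simp: a_def)
  next
    case False
    then show ?thesis
      using deriv_imp_increment_le[of \<eta> 0 I "\<lambda>_. 0" "\<lambda>_. 0" "\<lambda>_. 0"]
        deriv_imp_increment_le[of \<eta> 0 "\<lambda>_. 0" "\<lambda>_. 0" I "\<lambda>_. 0"] dI by (force simp: a_def)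
  qed
  moreover have "integral {0..c} (\<lambda>x. p (x + \<eta>)) = integral {\<eta>..\<eta> + c} p"
    using integral_shift_real_ivl[of \<eta> \<eta> "\<eta> + c" p] by simp
  ultimately show ?thesis using I[of 0] I[of \<eta>] by (simp add: a_def)
qed

section \<open>Means over circles\<close>

definition circle_mean :: "(plane \<Rightarrow> real) \<Rightarrow> real \<Rightarrow> real" where
  "circle_mean \<phi> r = integral {0..2 * pi} (\<lambda>\<theta>. \<phi> (polar r \<theta>)) / (2 * pi)"

lemma continuous_circle_mean:
  assumes cont: "continuous_on UNIV \<phi>"
  shows "continuous_on UNIV (circle_mean \<phi>)"
proof -
  have "continuous_on UNIV (\<lambda>r. integral (cbox 0 (2 * pi)) (\<lambda>\<theta>. \<phi> (polar r \<theta>)))"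
    by (rule integral_continuous_on_param)
       (unfold case_prod_beta, intro continuous_intros continuous_on_compose2[OF cont], auto)
  then show ?thesis
    unfolding circle_mean_def by (auto intro!: continuous_intros)
qed

lemma circle_mean_scale: "circle_mean (\<lambda>x. c * \<phi> x) r = c * circle_mean \<phi> r"
  by (simp add: circle_mean_def)

text \<open>The mean over the circle through \<open>x\<close> is the mean over the orbit of \<open>x\<close> under rotations. The
  first form is differentiated in the radius, the second one is used with Fubini's theorem.\<close>
lemma circle_mean_norm:
  assumes "continuous_on UNIV \<phi>"
  shows "circle_mean \<phi> (norm x) = integral {0..2 * pi} (\<lambda>\<theta>. \<phi> (rot \<theta> x)) / (2 * pi)"
proof -
  obtain \<eta> where \<eta>: "x = polar (norm x) \<eta>" by (rule polar_exists)
  have "continuous_on UNIV (\<lambda>\<theta>. \<phi> (polar (norm x) \<theta>))"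
    by (intro continuous_on_compose2[OF assms] continuous_intros) auto
  moreover have "polar (norm x) (\<theta> + 2 * pi) = polar (norm x) \<theta>" for \<theta>
    by (simp add: polar_def)
  ultimately have "integral {0..2 * pi} (\<lambda>\<theta>. \<phi> (polar (norm x) (\<theta> + \<eta>)))
      = integral {0..2 * pi} (\<lambda>\<theta>. \<phi> (polar (norm x) \<theta>))"
    by (intro integral_periodic_shift) auto
  moreover have "\<phi> (polar (norm x) (\<theta> + \<eta>)) = \<phi> (rot \<theta> x)" for \<theta>
    by (metis \<eta> rot_polar)
  ultimately show ?thesis by (simp add: circle_mean_def)
qed

text \<open>The derivative of the circle mean of a function whose gradient is \<open>D\<close>.\<close>
definition radial_slope :: "(plane \<Rightarrow> plane) \<Rightarrow> real \<Rightarrow> real" where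
  "radial_slope D r = integral {0..2 * pi} (\<lambda>\<theta>. D (polar r \<theta>) \<bullet> polar 1 \<theta>) / (2 * pi)"

lemma DERIV_circle_mean:
  assumes D: "\<And>x. GDERIV \<phi> x :> D x" and contD: "continuous_on UNIV D"
  shows "(circle_mean \<phi> has_real_derivative radial_slope D r) (at r)"
proof -
  have cont\<phi>: "continuous_on UNIV \<phi>"
    using D by (auto simp: gderiv_def intro!: has_derivative_continuous continuous_at_imp_continuous_on)
  have "((\<lambda>r. integral (cbox 0 (2 * pi)) (\<lambda>\<theta>. \<phi> (polar r \<theta>))) has_field_derivative
      integral (cbox 0 (2 * pi)) (\<lambda>\<theta>. D (polar r \<theta>) \<bullet> polar 1 \<theta>)) (at r within UNIV)"
  proof (rule leibniz_rule_field_derivative)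
    fix s \<theta> :: real
    have "((\<lambda>s. s *\<^sub>R polar 1 \<theta>) has_derivative (\<lambda>h. h *\<^sub>R polar 1 \<theta>)) (at s)"
      by (intro derivative_intros)
    moreover have "(\<lambda>s. polar s \<theta>) = (\<lambda>s. s *\<^sub>R polar 1 \<theta>)" by (simp add: polar_def)
    ultimately have "((\<lambda>s. polar s \<theta>) has_derivative (\<lambda>h. h *\<^sub>R polar 1 \<theta>)) (at s)"
      by (rule back_subst[where P="\<lambda>f. (f has_derivative _) _", OF _ sym])
    from has_derivative_compose[OF this D[of "polar s \<theta>", unfolded gderiv_def]]
    show "((\<lambda>s. \<phi> (polar s \<theta>)) has_field_derivative D (polar s \<theta>) \<bullet> polar 1 \<theta>) (at s within UNIV)"
      unfolding has_field_derivative_def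
      by (rule has_derivative_eq_rhs) (simp add: fun_eq_iff inner_commute mult.commute)
  next
    show "(\<lambda>\<theta>. \<phi> (polar s \<theta>)) integrable_on cbox 0 (2 * pi)" for s
      by (intro integrable_continuous continuous_on_compose2[OF cont\<phi>] continuous_intros) auto
    show "continuous_on (UNIV \<times> cbox 0 (2 * pi)) (\<lambda>(s, \<theta>). D (polar s \<theta>) \<bullet> polar 1 \<theta>)"
      unfolding case_prod_beta
      by (intro continuous_intros continuous_on_compose2[OF contD]) auto
  qed auto
  then show ?thesis
    unfolding circle_mean_def radial_slope_def by (auto intro: DERIV_cdivide)
qed

lemma continuous_radial_slope:
  assumes contD: "continuous_on UNIV D"
  shows "continuous_on UNIV (radial_slope D)"
proof -
  have "continuous_on UNIV (\<lambda>r. integral (cbox 0 (2 * pi)) (\<lambda>\<theta>. D (polar r \<theta>) \<bullet> polar 1 \<theta>))"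
    by (rule integral_continuous_on_param)
       (unfold case_prod_beta, intro continuous_intros continuous_on_compose2[OF contD], auto)
  then show ?thesis unfolding radial_slope_def by (auto intro!: continuous_intros)
qed

lemma mean_square_le:
  fixes p :: "real \<Rightarrow> real"
  assumes c: "0 < c" and cont: "continuous_on {0..c} p"
  shows "(integral {0..c} p / c)\<^sup>2 \<le> integral {0..c} (\<lambda>x. (p x)\<^sup>2) / c"
proof -
  define m where "m = integral {0..c} p / c"
  have "0 \<le> integral {0..c} (\<lambda>x. (p x - m)\<^sup>2)"
    by (intro integral_nonneg integrable_continuous_interval continuous_intros cont) auto
  also have "integral {0..c} (\<lambda>x. (p x - m)\<^sup>2) = integral {0..c} (\<lambda>x. ((p x)\<^sup>2 - (2 * m) * p x) + m\<^sup>2)"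
    by (intro integral_cong) (simp add: power2_eq_square algebra_simps)
  also have "\<dots> = integral {0..c} (\<lambda>x. (p x)\<^sup>2) - (2 * m) * integral {0..c} p + c * m\<^sup>2"
    using c by (subst integral_add integral_diff integral_mult_right;
        (intro integrable_continuous_interval continuous_intros cont)?)+ simp_all
  also have "integral {0..c} p = c * m" using c by (simp add: m_def)
  finally have "c * m\<^sup>2 \<le> integral {0..c} (\<lambda>x. (p x)\<^sup>2)" by (simp add: power2_eq_square algebra_simps)
  then show ?thesis using c by (simp add: m_def[symmetric] field_simps)
qed

lemma radial_slope_square_le:
  assumes contD: "continuous_on UNIV D"
  shows "(radial_slope D r)\<^sup>2 \<le> circle_mean (\<lambda>x. (norm (D x))\<^sup>2) r"
proof -
  have cont: "continuous_on S (\<lambda>\<theta>. D (polar r \<theta>))" for S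
    by (intro continuous_on_compose2[OF contD] continuous_intros) auto
  have "(radial_slope D r)\<^sup>2 \<le> integral {0..2 * pi} (\<lambda>\<theta>. (D (polar r \<theta>) \<bullet> polar 1 \<theta>)\<^sup>2) / (2 * pi)"
    unfolding radial_slope_def by (intro mean_square_le continuous_intros cont) auto
  also have "\<dots> \<le> circle_mean (\<lambda>x. (norm (D x))\<^sup>2) r"
    unfolding circle_mean_def
  proof (intro divide_right_mono integral_le integrable_continuous_interval continuous_intros cont)
    fix \<theta>
    have "\<bar>D (polar r \<theta>) \<bullet> polar 1 \<theta>\<bar> \<le> norm (D (polar r \<theta>))"
      using Cauchy_Schwarz_ineq2[of "D (polar r \<theta>)" "polar 1 \<theta>"] by simp
    then show "(D (polar r \<theta>) \<bullet> polar 1 \<theta>)\<^sup>2 \<le> (norm (D (polar r \<theta>)))\<^sup>2"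
      by (metis abs_ge_zero power2_abs power_mono)
  qed auto
  finally show ?thesis .
qed

lemma ennreal_circle_mean:
  assumes cont: "continuous_on UNIV G" and nonneg: "\<And>x. 0 \<le> G x"
  shows "ennreal (circle_mean G (norm x))
      = ennreal (1 / (2 * pi)) * (\<integral>\<^sup>+\<theta>\<in>{0..2 * pi}. ennreal (G (rot \<theta> x)) \<partial>lborel)"
proof -
  have "continuous_on {0..2 * pi} (\<lambda>\<theta>. G (rot \<theta> x))"
    by (intro continuous_on_compose2[OF cont] continuous_intros) auto
  then have "(\<integral>\<^sup>+\<theta>\<in>{0..2 * pi}. ennreal (G (rot \<theta> x)) \<partial>lborel)
      = ennreal (integral {0..2 * pi} (\<lambda>\<theta>. G (rot \<theta> x)))"
    using nonneg by (intro nn_integral_Icc_eq_integral) auto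
  then show ?thesis
    unfolding circle_mean_norm[OF cont] by (simp add: ennreal_mult'[symmetric])
qed

lemma nn_integral_circle_mean:
  assumes cont: "continuous_on UNIV G" and nonneg: "\<And>x. 0 \<le> G x"
    and w[measurable]: "w \<in> borel_measurable borel"
  shows "(\<integral>\<^sup>+x. ennreal (circle_mean G (norm (x::plane))) * w (norm x) \<partial>lborel)
      = (\<integral>\<^sup>+x. ennreal (G x) * w (norm x) \<partial>lborel)"
proof -
  have [measurable]: "G \<in> borel_measurable borel"
    using cont by (rule borel_measurable_continuous_onI)
  define h where "h x = ennreal (1 / (2 * pi)) * (ennreal (G x) * w (norm x))" for x
  have [measurable]: "h \<in> borel_measurable borel" unfolding h_def by measurable
  have "ennreal (circle_mean G (norm x)) * w (norm x)
      = (\<integral>\<^sup>+\<theta>\<in>{0..2 * pi}. h (rot \<theta> x) \<partial>lborel)" for x :: plane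
  proof -
    have "(\<integral>\<^sup>+\<theta>\<in>{0..2 * pi}. h (rot \<theta> x) \<partial>lborel)
        = (\<integral>\<^sup>+\<theta>. (ennreal (1 / (2 * pi)) * w (norm x)) * (ennreal (G (rot \<theta> x)) * indicator {0..2 * pi} \<theta>) \<partial>lborel)"
      by (intro nn_integral_cong) (simp add: h_def mult_ac)
    also have "\<dots> = (ennreal (1 / (2 * pi)) * w (norm x)) * (\<integral>\<^sup>+\<theta>\<in>{0..2 * pi}. ennreal (G (rot \<theta> x)) \<partial>lborel)"
      by (rule nn_integral_cmult) measurable
    finally show ?thesis
      unfolding ennreal_circle_mean[OF cont nonneg] by (simp add: mult_ac)
  qed
  then have "(\<integral>\<^sup>+x. ennreal (circle_mean G (norm (x::plane))) * w (norm x) \<partial>lborel)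
      = (\<integral>\<^sup>+x. (\<integral>\<^sup>+\<theta>\<in>{0..2 * pi}. h (rot \<theta> x) \<partial>lborel) \<partial>lborel)"
    by simp
  also have "\<dots> = ennreal (2 * pi) * (\<integral>\<^sup>+x. h x \<partial>lborel)"
    by (rule nn_integral_rot_average) measurable
  also have "(\<integral>\<^sup>+x. h x \<partial>lborel) = ennreal (1 / (2 * pi)) * (\<integral>\<^sup>+x. ennreal (G x) * w (norm x) \<partial>lborel)"
    unfolding h_def by (rule nn_integral_cmult) measurable
  also have "ennreal (2 * pi) * (ennreal (1 / (2 * pi)) * (\<integral>\<^sup>+x. ennreal (G x) * w (norm x) \<partial>lborel))
      = (\<integral>\<^sup>+x. ennreal (G x) * w (norm x) \<partial>lborel)"
    by (simp add: mult.assoc[symmetric] ennreal_mult'[symmetric])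
  finally show ?thesis .
qed

text \<open>A radial function is its own circle mean, and averaging is a contraction of \<open>L\<^sup>1\<close>. Since
  \<open>u\<close> is radial only up to a null set, the invariance \<open>u (rot \<theta> x) = u x\<close> is used for each fixed
  \<open>\<theta>\<close> outside a null set of \<open>x\<close>; this is why the two integrations are exchanged first.\<close>
lemma nn_integral_circle_mean_diff_le:
  assumes cont: "continuous_on UNIV \<phi>" and u[measurable]: "u \<in> borel_measurable borel"
    and rad: "AE x in lborel. x \<in> unit_disc \<longrightarrow> u x = f (norm x)"
  shows "(\<integral>\<^sup>+x\<in>unit_disc. ennreal \<bar>circle_mean \<phi> (norm x) - u x\<bar> \<partial>lborel)
      \<le> (\<integral>\<^sup>+x\<in>unit_disc. ennreal \<bar>\<phi> x - u x\<bar> \<partial>lborel)"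
proof -
  have [measurable]: "\<phi> \<in> borel_measurable borel"
    using cont by (rule borel_measurable_continuous_onI)
  have [measurable]: "(indicator unit_disc :: plane \<Rightarrow> ennreal) \<in> borel_measurable borel"
    by (rule borel_measurable_indicator) simp
  define q where "q \<theta> x = ennreal \<bar>\<phi> (rot \<theta> x) - u x\<bar> * indicator unit_disc x" for \<theta> and x :: plane
  define h where "h x = ennreal \<bar>\<phi> x - u x\<bar> * indicator unit_disc x" for x :: plane
  have [measurable]: "h \<in> borel_measurable borel" unfolding h_def by measurable
  have [measurable]: "(\<lambda>p. q (fst p) (snd p)) \<in> borel_measurable (borel \<Otimes>\<^sub>M borel)"
    unfolding q_def by measurable
  have [measurable]: "(\<lambda>(x, \<theta>). q \<theta> x) \<in> borel_measurable (borel \<Otimes>\<^sub>M borel)"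
    unfolding q_def by measurable
  have pw: "ennreal \<bar>circle_mean \<phi> (norm x) - u x\<bar> * indicator unit_disc x
      \<le> ennreal (1 / (2 * pi)) * (\<integral>\<^sup>+\<theta>. q \<theta> x * indicator {0..2 * pi} \<theta> \<partial>lborel)" for x
  proof (cases "x \<in> unit_disc")
    case True
    have c: "continuous_on {0..2 * pi} (\<lambda>\<theta>. \<phi> (rot \<theta> x) - u x)"
      by (intro continuous_on_compose2[OF cont] continuous_intros) auto
    have i: "(\<lambda>\<theta>. \<phi> (rot \<theta> x)) integrable_on {0..2 * pi}"
      by (intro integrable_continuous_interval continuous_on_compose2[OF cont] continuous_intros) auto
    have "circle_mean \<phi> (norm x) - u x = integral {0..2 * pi} (\<lambda>\<theta>. \<phi> (rot \<theta> x) - u x) / (2 * pi)"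
      using i unfolding circle_mean_norm[OF cont]
      by (subst integral_diff) (auto simp: diff_divide_distrib)
    also have "\<bar>\<dots>\<bar> \<le> integral {0..2 * pi} (\<lambda>\<theta>. \<bar>\<phi> (rot \<theta> x) - u x\<bar>) / (2 * pi)"
    proof -
      have "norm (integral {0..2 * pi} (\<lambda>\<theta>. \<phi> (rot \<theta> x) - u x))
          \<le> integral {0..2 * pi} (\<lambda>\<theta>. \<bar>\<phi> (rot \<theta> x) - u x\<bar>)"
        by (rule integral_norm_bound_integral)
           (use c in \<open>auto intro!: integrable_continuous_interval continuous_intros\<close>)
      then show ?thesis by (simp add: divide_right_mono)
    qed
    finally have "ennreal \<bar>circle_mean \<phi> (norm x) - u x\<bar>
        \<le> ennreal (integral {0..2 * pi} (\<lambda>\<theta>. \<bar>\<phi> (rot \<theta> x) - u x\<bar>) / (2 * pi))"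
      by (rule ennreal_leI)
    also have "\<dots> = ennreal (1 / (2 * pi)) * ennreal (integral {0..2 * pi} (\<lambda>\<theta>. \<bar>\<phi> (rot \<theta> x) - u x\<bar>))"
      by (simp add: ennreal_mult'[symmetric])
    also have "ennreal (integral {0..2 * pi} (\<lambda>\<theta>. \<bar>\<phi> (rot \<theta> x) - u x\<bar>))
        = (\<integral>\<^sup>+\<theta>. q \<theta> x * indicator {0..2 * pi} \<theta> \<partial>lborel)"
      using True c by (subst nn_integral_Icc_eq_integral[symmetric]) (auto simp: q_def intro!: continuous_intros)
    finally show ?thesis using True by simp
  qed simp
  have inner: "(\<integral>\<^sup>+x. q \<theta> x \<partial>lborel) = (\<integral>\<^sup>+x. h x \<partial>lborel)" for \<theta>
  proof -
    have "(\<integral>\<^sup>+x. q \<theta> x \<partial>lborel) = (\<integral>\<^sup>+x. h (rot \<theta> x) \<partial>lborel)"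
    proof (rule nn_integral_cong_AE)
      show "AE x in lborel. q \<theta> x = h (rot \<theta> x)"
        using rad AE_rot[OF rad, of \<theta>]
      proof eventually_elim
        case (elim x)
        then show ?case by (auto simp: q_def h_def indicator_def)
      qed
    qed
    then show ?thesis by (simp add: nn_integral_rot)
  qed
  have "(\<integral>\<^sup>+x\<in>unit_disc. ennreal \<bar>circle_mean \<phi> (norm x) - u x\<bar> \<partial>lborel)
      \<le> (\<integral>\<^sup>+x. ennreal (1 / (2 * pi)) * (\<integral>\<^sup>+\<theta>. q \<theta> x * indicator {0..2 * pi} \<theta> \<partial>lborel) \<partial>lborel)"
    by (intro nn_integral_mono pw)
  also have "\<dots> = ennreal (1 / (2 * pi)) * (\<integral>\<^sup>+x. (\<integral>\<^sup>+\<theta>. q \<theta> x * indicator {0..2 * pi} \<theta> \<partial>lborel) \<partial>lborel)"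
    by (rule nn_integral_cmult) measurable
  also have "(\<integral>\<^sup>+x. (\<integral>\<^sup>+\<theta>. q \<theta> x * indicator {0..2 * pi} \<theta> \<partial>lborel) \<partial>lborel)
      = (\<integral>\<^sup>+\<theta>. (\<integral>\<^sup>+x. q \<theta> x * indicator {0..2 * pi} \<theta> \<partial>lborel) \<partial>lborel)"
    by (rule lborel_pair.Fubini') measurable
  also have "\<dots> = (\<integral>\<^sup>+\<theta>. (\<integral>\<^sup>+x. h x \<partial>lborel) * indicator {0..2 * pi} \<theta> \<partial>lborel)"
    by (subst nn_integral_multc) (auto simp: inner)
  also have "\<dots> = (\<integral>\<^sup>+x. h x \<partial>lborel) * ennreal (2 * pi)"
    by (subst nn_integral_cmult) auto
  also have "ennreal (1 / (2 * pi)) * ((\<integral>\<^sup>+x. h x \<partial>lborel) * ennreal (2 * pi)) = (\<integral>\<^sup>+x. h x \<partial>lborel)"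
  proof -
    have "ennreal (1 / (2 * pi)) * ennreal (2 * pi) = 1" by (simp add: ennreal_mult'[symmetric])
    then show ?thesis by (metis mult.left_commute mult.right_neutral)
  qed
  finally show ?thesis by (simp add: h_def)
qed

section \<open>The Moser integral of averaged functions in the disc\<close>

lemma w0_measurable [measurable]: "w0 \<beta> \<in> borel_measurable borel"
  unfolding w0_def by measurable

lemma w0_nonneg [simp]: "0 \<le> w0 \<beta> x"
  by (simp add: w0_def)

lemma neg_two_ln_le_iff:
  fixes r :: real
  assumes "0 < r"
  shows "- 2 * ln r \<le> A \<longleftrightarrow> exp (- A / 2) \<le> r"
proof -
  have "- 2 * ln r \<le> A \<longleftrightarrow> - A / 2 \<le> ln r" by auto
  also have "\<dots> \<longleftrightarrow> exp (- A / 2) \<le> r" using assms by (rule ln_ge_iff)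
  finally show ?thesis .
qed

text \<open>By Jensen's inequality, averaging over circles does not increase the energy. If \<open>D\<close> is a
  gradient, then \<open>H'\<close> is the derivative of the averaged profile in the variable
  \<open>t = - 2 * ln r\<close>, and the set \<open>I\<close> of values of \<open>t\<close> selects a rotation invariant part of the disc.\<close>
lemma nn_integral_radial_energy_le:
  assumes contD: "continuous_on UNIV D"
    and I[measurable]: "I \<in> sets borel"
    and H': "\<And>t. H' t = - (radial_slope D (exp (- t / 2)) * exp (- t / 2) / 2)"
  shows "(\<integral>\<^sup>+t\<in>{0..}. ennreal (4 * pi * (H' t)\<^sup>2 * (t / 2) powr \<beta>) * indicator I t \<partial>lborel)
      \<le> (\<integral>\<^sup>+x\<in>unit_disc. ennreal ((norm (D x))\<^sup>2 * w0 \<beta> x) * indicator I (- 2 * ln (norm x)) \<partial>lborel)"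
proof -
  define k where "k = radial_slope D"
  have contk: "continuous_on UNIV k" unfolding k_def by (rule continuous_radial_slope[OF contD])
  have [measurable]: "k \<in> borel_measurable borel"
    using contk by (rule borel_measurable_continuous_onI)
  define g where "g t = ennreal ((k (exp (- t / 2)))\<^sup>2 * \<bar>t / 2\<bar> powr \<beta>) * indicator I t" for t
  define w where "w r = ennreal (\<bar>ln r\<bar> powr \<beta>) * indicator {..<1} r * indicator I (- 2 * ln r)" for r
  have [measurable]: "g \<in> borel_measurable borel" unfolding g_def by measurable
  have w[measurable]: "w \<in> borel_measurable borel" unfolding w_def by measurable
  have contD2: "continuous_on UNIV (\<lambda>x. (norm (D x))\<^sup>2)" by (intro continuous_intros contD)
  have "(\<integral>\<^sup>+t\<in>{0..}. ennreal (4 * pi * (H' t)\<^sup>2 * (t / 2) powr \<beta>) * indicator I t \<partial>lborel)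
      = (\<integral>\<^sup>+t\<in>{0..}. ennreal (pi * exp (- t)) * g t \<partial>lborel)"
  proof (rule nn_integral_cong)
    fix t :: real
    have "(exp (- t / 2))\<^sup>2 = exp (- t)" by (simp add: power2_eq_square exp_add[symmetric])
    then have "4 * pi * (H' t)\<^sup>2 * (t / 2) powr \<beta> = pi * exp (- t) * ((k (exp (- t / 2)))\<^sup>2 * \<bar>t / 2\<bar> powr \<beta>)" if "0 \<le> t"
      using that by (simp add: H' k_def[symmetric] power_divide power_mult_distrib)
    then show "ennreal (4 * pi * (H' t)\<^sup>2 * (t / 2) powr \<beta>) * indicator I t * indicator {0..} t
        = ennreal (pi * exp (- t)) * g t * indicator {0..} t"
      by (auto simp: g_def indicator_def ennreal_mult'[symmetric])
  qed
  also have "\<dots> = (\<integral>\<^sup>+x\<in>unit_disc. g (- 2 * ln (norm x)) \<partial>lborel)"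
    by (rule nn_integral_disc_radial[symmetric]) measurable
  also have "\<dots> \<le> (\<integral>\<^sup>+x. ennreal (circle_mean (\<lambda>x. (norm (D x))\<^sup>2) (norm (x :: plane))) * w (norm x) \<partial>lborel)"
  proof (rule nn_integral_mono_AE)
    show "AE x::plane in lborel. g (- 2 * ln (norm x)) * indicator unit_disc x
        \<le> ennreal (circle_mean (\<lambda>x. (norm (D x))\<^sup>2) (norm x)) * w (norm x)"
      using AE_lborel_singleton[of "0::plane"]
    proof eventually_elim
      case (elim x)
      then have "g (- 2 * ln (norm x)) * indicator unit_disc x
          = ennreal ((k (norm x))\<^sup>2) * w (norm x)"
        by (auto simp: g_def w_def indicator_def ennreal_mult')
      also have "\<dots> \<le> ennreal (circle_mean (\<lambda>x. (norm (D x))\<^sup>2) (norm x)) * w (norm x)"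
        using radial_slope_square_le[OF contD, of "norm x"] by (intro mult_right_mono ennreal_leI) (auto simp: k_def)
      finally show ?case .
    qed
  qed
  also have "\<dots> = (\<integral>\<^sup>+x. ennreal ((norm (D x))\<^sup>2) * w (norm x) \<partial>lborel)"
    by (rule nn_integral_circle_mean[OF contD2 _ w]) simp
  also have "\<dots> = (\<integral>\<^sup>+x\<in>unit_disc. ennreal ((norm (D x))\<^sup>2 * w0 \<beta> x) * indicator I (- 2 * ln (norm x)) \<partial>lborel)"
    by (rule nn_integral_cong) (auto simp: w_def w0_def indicator_def ennreal_mult')
  finally show ?thesis .
qed

lemma disc_moser_bound:
  assumes \<beta>: "0 \<le> \<beta>" "\<beta> < 1"
    and D: "\<And>x. GDERIV \<phi> x :> D x" and contD: "continuous_on UNIV D"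
    and R: "0 < R" "R < 1" and supp: "\<And>x. R \<le> norm x \<Longrightarrow> \<phi> x = 0"
    and energy: "(\<integral>\<^sup>+x\<in>unit_disc. ennreal ((norm (D x))\<^sup>2 * w0 \<beta> x) \<partial>lborel) \<le> 1"
    and tail: "(\<integral>\<^sup>+x\<in>unit_disc - ball 0 (exp (- A / 2)). ennreal ((norm (D x))\<^sup>2 * w0 \<beta> x) \<partial>lborel) \<le> ennreal \<eta>"
    and A: "3 \<le> A" and \<eta>: "0 < \<eta>" "\<eta> < 1 - 2 * ln A / A"
  shows "(\<integral>\<^sup>+x\<in>unit_disc. ennreal (exp (alpha \<beta> * \<bar>circle_mean \<phi> (norm x)\<bar> powr (2 / (1 - \<beta>)))) \<partial>lborel)
      \<le> ennreal pi * ennreal (exp (A * \<eta>) + 1 / A + exp 1 / (1 - 2 * ln A / A))"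
proof -
  define H where "H t = circle_mean \<phi> (exp (- t / 2))" for t
  define H' where "H' t = - (radial_slope D (exp (- t / 2)) * exp (- t / 2) / 2)" for t
  define t1 where "t1 = - 2 * ln R"
  have t1: "0 < t1" using R by (simp add: t1_def)
  have dH: "(H has_real_derivative H' t) (at t)" for t
  proof -
    have "((\<lambda>t. exp (- t / 2)) has_real_derivative - exp (- t / 2) / 2) (at t)"
      by (auto intro!: derivative_eq_intros)
    from DERIV_chain2[OF DERIV_circle_mean[OF D contD] this] show ?thesis
      by (simp add: H_def[abs_def] H'_def)
  qed
  have contH': "continuous_on UNIV H'"
    unfolding H'_def
    by (intro continuous_intros continuous_on_compose2[OF continuous_radial_slope[OF contD]]) auto
  have H0: "H t = 0" if "t \<le> t1" for t
  proof -
    have "ln R \<le> - t / 2" using that by (simp add: t1_def)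
    then have "R \<le> exp (- t / 2)" using R by (metis exp_le_cancel_iff exp_ln)
    then have "\<phi> (polar (exp (- t / 2)) \<theta>) = 0" for \<theta> by (intro supp) simp
    then show ?thesis by (simp add: H_def circle_mean_def)
  qed
  \<comment> \<open>Halving \<open>t1\<close> leaves room for an open neighbourhood on which \<open>H\<close> vanishes.\<close>
  have H'0: "H' t = 0" if "t \<le> t1 / 2" for t
  proof -
    have "((\<lambda>_. 0) has_real_derivative 0) (at t)" by simp
    then have "(H has_real_derivative 0) (at t)"
      by (rule has_field_derivative_transform_within_open[where S="{..<t1}"])
         (use that t1 H0 in auto)
    then show ?thesis using dH DERIV_unique by blast
  qed
  have [measurable]: "H \<in> borel_measurable borel"
    by (intro borel_measurable_continuous_onI continuous_at_imp_continuous_on ballI DERIV_isCont[OF dH])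
  define g where "g t = ennreal (exp (alpha \<beta> * \<bar>H t\<bar> powr (2 / (1 - \<beta>))))" for t
  have [measurable]: "g \<in> borel_measurable borel" unfolding g_def by measurable
  have "(\<integral>\<^sup>+x\<in>unit_disc. ennreal (exp (alpha \<beta> * \<bar>circle_mean \<phi> (norm x)\<bar> powr (2 / (1 - \<beta>)))) \<partial>lborel)
      = (\<integral>\<^sup>+x\<in>unit_disc. g (- 2 * ln (norm x)) \<partial>lborel)"
  proof (rule nn_integral_cong_AE)
    show "AE x::plane in lborel. ennreal (exp (alpha \<beta> * \<bar>circle_mean \<phi> (norm x)\<bar> powr (2 / (1 - \<beta>)))) * indicator unit_disc x
        = g (- 2 * ln (norm x)) * indicator unit_disc x"
      using AE_lborel_singleton[of "0::plane"]
      by eventually_elim (simp add: g_def H_def)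
  qed
  also have "\<dots> = (\<integral>\<^sup>+t\<in>{0..}. ennreal (pi * exp (- t)) * g t \<partial>lborel)"
    by (rule nn_integral_disc_radial) measurable
  also have "\<dots> = (\<integral>\<^sup>+t. ennreal pi * (ennreal (exp (alpha \<beta> * \<bar>H t\<bar> powr (2 / (1 - \<beta>)) - t)) * indicator {0..} t) \<partial>lborel)"
    by (rule nn_integral_cong) (auto simp: g_def indicator_def ennreal_mult'[symmetric] exp_diff exp_minus field_simps)
  also have "\<dots> = ennreal pi * (\<integral>\<^sup>+t\<in>{0..}. ennreal (exp (alpha \<beta> * \<bar>H t\<bar> powr (2 / (1 - \<beta>)) - t)) \<partial>lborel)"
    by (rule nn_integral_cmult) measurable
  also have "\<dots> \<le> ennreal pi * ennreal (exp (A * \<eta>) + 1 / A + exp 1 / (1 - 2 * ln A / A))"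
  proof (rule mult_left_mono[OF weighted_moser_bound[OF \<beta> _ dH contH']])
    show "0 < t1 / 2" using t1 by simp
    show "H t = 0" if "t \<le> t1 / 2" for t using H0[of t] that t1 by simp
    show "H' t = 0" if "t \<le> t1 / 2" for t by (rule H'0[OF that])
    have "(\<integral>\<^sup>+t\<in>{0..}. ennreal (4 * pi * (H' t)\<^sup>2 * (t / 2) powr \<beta>) \<partial>lborel)
        = (\<integral>\<^sup>+t\<in>{0..}. ennreal (4 * pi * (H' t)\<^sup>2 * (t / 2) powr \<beta>) * indicator UNIV t \<partial>lborel)"
      by simp
    also have "\<dots> \<le> (\<integral>\<^sup>+x\<in>unit_disc. ennreal ((norm (D x))\<^sup>2 * w0 \<beta> x) * indicator UNIV (- 2 * ln (norm x)) \<partial>lborel)"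
      by (rule nn_integral_radial_energy_le[OF contD _ H'_def]) simp
    also have "\<dots> \<le> 1" using energy by simp
    finally show "(\<integral>\<^sup>+t\<in>{0..}. ennreal (4 * pi * (H' t)\<^sup>2 * (t / 2) powr \<beta>) \<partial>lborel) \<le> 1" .
    have "(\<integral>\<^sup>+t\<in>{0..A}. ennreal (4 * pi * (H' t)\<^sup>2 * (t / 2) powr \<beta>) \<partial>lborel)
        = (\<integral>\<^sup>+t\<in>{0..}. ennreal (4 * pi * (H' t)\<^sup>2 * (t / 2) powr \<beta>) * indicator {..A} t \<partial>lborel)"
      by (intro nn_integral_cong) (auto simp: indicator_def)
    also have "\<dots> \<le> (\<integral>\<^sup>+x\<in>unit_disc. ennreal ((norm (D x))\<^sup>2 * w0 \<beta> x) * indicator {..A} (- 2 * ln (norm x)) \<partial>lborel)"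
      by (rule nn_integral_radial_energy_le[OF contD _ H'_def]) simp
    also have "\<dots> \<le> (\<integral>\<^sup>+x\<in>unit_disc - ball 0 (exp (- A / 2)). ennreal ((norm (D x))\<^sup>2 * w0 \<beta> x) \<partial>lborel)"
    proof (rule nn_integral_mono_AE)
      show "AE x in lborel. ennreal ((norm (D x))\<^sup>2 * w0 \<beta> x) * indicator {..A} (- 2 * ln (norm x)) * indicator unit_disc x
          \<le> ennreal ((norm (D x))\<^sup>2 * w0 \<beta> x) * indicator (unit_disc - ball 0 (exp (- A / 2))) x"
        using AE_lborel_singleton[of "0::plane"]
      proof eventually_elim
        case (elim x)
        then show ?case using neg_two_ln_le_iff[of "norm x" A] by (auto simp: indicator_def)
      qed
    qed
    also note tail
    finally show "(\<integral>\<^sup>+t\<in>{0..A}. ennreal (4 * pi * (H' t)\<^sup>2 * (t / 2) powr \<beta>) \<partial>lborel) \<le> ennreal \<eta>" .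
  qed (use A \<eta> in auto)
  finally show ?thesis .
qed

lemma test_function_gradient:
  assumes "test_function \<phi>"
  shows "GDERIV \<phi> x :> gradient \<phi> x" and "continuous_on UNIV (gradient \<phi>)"
proof -
  have "C_k (Suc 0) \<phi>" using assms by (auto simp only: test_function_def)
  then obtain D where D: "\<And>x. GDERIV \<phi> x :> D x" and c: "\<And>i. continuous_on UNIV (\<lambda>x. D x $ i)"
    by auto
  have uniq: "E = D x" if "GDERIV \<phi> x :> E" for x E
  proof -
    have "(\<lambda>h. h \<bullet> E) = (\<lambda>h. h \<bullet> D x)"
      using that D[of x] unfolding gderiv_def by (rule has_derivative_unique)
    then have "\<forall>h. h \<bullet> E = h \<bullet> D x" by (simp add: fun_eq_iff)
    then show ?thesis by (rule vector_eq_ldot[THEN iffD1])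
  qed
  have g: "gradient \<phi> = D"
  proof
    show "gradient \<phi> x = D x" for x
      unfolding gradient_def using D uniq by (rule the_equality)
  qed
  show "GDERIV \<phi> x :> gradient \<phi> x" using D by (simp add: g)
  have "continuous_on UNIV (\<lambda>x. \<chi> i. D x $ i)" using c by (rule continuous_on_vec_lambda)
  then show "continuous_on UNIV (gradient \<phi>)" by (simp add: g)
qed

lemma test_function_support:
  assumes "test_function \<phi>"
  obtains R where "0 < R" "R < 1" "\<And>x. R \<le> norm x \<Longrightarrow> \<phi> x = 0"
proof -
  define K where "K = closure {x. \<phi> x \<noteq> 0}"
  have K: "compact K" "K \<subseteq> unit_disc" using assms by (auto simp: test_function_def K_def)
  have sub: "x \<in> K" if "\<phi> x \<noteq> 0" for x using that closure_subset[of "{x. \<phi> x \<noteq> 0}"] by (auto simp: K_def)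
  show ?thesis
  proof (cases "K = {}")
    case True
    then show ?thesis using sub by (intro that[of "1 / 2"]) auto
  next
    case False
    have "continuous_on K norm" by (intro continuous_intros)
    from continuous_attains_sup[OF K(1) False this]
    obtain y where y: "y \<in> K" "\<And>x. x \<in> K \<Longrightarrow> norm x \<le> norm y" by blast
    have y1: "norm y < 1" using y K by auto
    show ?thesis
    proof (rule that[of "(1 + norm y) / 2"])
      show "0 < (1 + norm y) / 2" by (simp add: add_pos_nonneg)
      show "(1 + norm y) / 2 < 1" using y1 by simp
      show "\<phi> x = 0" if "(1 + norm y) / 2 \<le> norm x" for x
      proof (rule ccontr)
        assume "\<phi> x \<noteq> 0"
        then have "norm x \<le> norm y" using y(2) sub by blast
        then show False using that y1 by simp
      qed
    qed
  qed
qed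

text \<open>In the variable \<open>t\<close> the weight is \<open>(t / 2) powr \<beta> \<le> 1 + t\<close>, which is integrable against \<open>exp (- t)\<close>.\<close>
lemma nn_integral_w0_finite:
  assumes "0 \<le> \<beta>" "\<beta> \<le> 1"
  shows "(\<integral>\<^sup>+x\<in>unit_disc. ennreal (w0 \<beta> x) \<partial>lborel) < \<infinity>"
proof -
  define g where "g t = ennreal (\<bar>t / 2\<bar> powr \<beta>)" for t :: real
  have [measurable]: "g \<in> borel_measurable borel" unfolding g_def by measurable
  have "(\<integral>\<^sup>+x\<in>unit_disc. ennreal (w0 \<beta> x) \<partial>lborel) = (\<integral>\<^sup>+x\<in>unit_disc. g (- 2 * ln (norm x)) \<partial>lborel)"
    by (simp add: g_def w0_def)
  also have "\<dots> = (\<integral>\<^sup>+t\<in>{0..}. ennreal (pi * exp (- t)) * g t \<partial>lborel)"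
    by (rule nn_integral_disc_radial) measurable
  also have "\<dots> \<le> (\<integral>\<^sup>+t\<in>{0..}. ennreal (pi * (exp (- t) * (1 + t))) \<partial>lborel)"
  proof (rule nn_integral_mono)
    fix t :: real
    have "\<bar>t / 2\<bar> powr \<beta> \<le> 1 + t" if "0 \<le> t"
    proof (cases "t / 2 \<le> 1")
      case True
      then have "\<bar>t / 2\<bar> powr \<beta> \<le> 1" using powr_mono2[of \<beta> "\<bar>t / 2\<bar>" 1] assms that by simp
      then show ?thesis using that by simp
    next
      case False
      then have "\<bar>t / 2\<bar> powr \<beta> \<le> \<bar>t / 2\<bar> powr 1" using assms by (intro powr_mono) auto
      then show ?thesis using that by simp
    qed
    then show "ennreal (pi * exp (- t)) * g t * indicator {0..} t
        \<le> ennreal (pi * (exp (- t) * (1 + t))) * indicator {0..} t"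
      by (auto simp: indicator_def g_def ennreal_mult'[symmetric] mult.assoc intro!: ennreal_leI mult_left_mono)
  qed
  also have "\<dots> = ennreal (0 - (- pi * (exp (- 0) * (2 + 0))))"
    by (rule nn_integral_FTC_atLeast)
       (auto intro!: derivative_eq_intros simp: algebra_simps, real_asymp)
  also have "\<dots> < \<infinity>" by simp
  finally show ?thesis .
qed

lemma test_function_energy_finite:
  assumes "0 \<le> \<beta>" "\<beta> \<le> 1" "test_function \<phi>"
  shows "(\<integral>\<^sup>+x\<in>unit_disc. ennreal ((norm (gradient \<phi> x))\<^sup>2 * w0 \<beta> x) \<partial>lborel) < \<infinity>"
proof -
  have "compact (gradient \<phi> ` cball 0 1)"
    by (intro compact_continuous_image continuous_on_subset[OF test_function_gradient(2)[OF assms(3)]]) auto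
  then obtain K where K: "\<forall>x\<in>cball 0 1. norm (gradient \<phi> x) \<le> K"
    using compact_imp_bounded[of "gradient \<phi> ` cball 0 1"] by (auto simp: bounded_iff)
  have [measurable]: "(indicator unit_disc :: plane \<Rightarrow> ennreal) \<in> borel_measurable borel"
    by (rule borel_measurable_indicator) simp
  have "(\<integral>\<^sup>+x\<in>unit_disc. ennreal ((norm (gradient \<phi> x))\<^sup>2 * w0 \<beta> x) \<partial>lborel)
      \<le> (\<integral>\<^sup>+x. ennreal (K\<^sup>2) * (ennreal (w0 \<beta> x) * indicator unit_disc x) \<partial>lborel)"
  proof (rule nn_integral_mono)
    fix x :: plane
    show "ennreal ((norm (gradient \<phi> x))\<^sup>2 * w0 \<beta> x) * indicator unit_disc x
        \<le> ennreal (K\<^sup>2) * (ennreal (w0 \<beta> x) * indicator unit_disc x)"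
      using K by (auto simp: indicator_def ennreal_mult'[symmetric] intro!: ennreal_leI mult_right_mono power_mono)
  qed
  also have "\<dots> = ennreal (K\<^sup>2) * (\<integral>\<^sup>+x\<in>unit_disc. ennreal (w0 \<beta> x) \<partial>lborel)"
    by (rule nn_integral_cmult) measurable
  also have "\<dots> < \<infinity>"
    using nn_integral_w0_finite[OF assms(1,2)] by (simp add: ennreal_mult_less_top)
  finally show ?thesis .
qed

section \<open>Approximation in the weighted space\<close>

lemma sq_norm_le_perturbed:
  fixes a b :: "'a::real_normed_vector"
  assumes \<delta>: "0 < \<delta>"
  shows "(norm a)\<^sup>2 \<le> (1 + \<delta>) * (norm b)\<^sup>2 + (1 + 1 / \<delta>) * (norm (a - b))\<^sup>2"
proof -
  have "norm a \<le> norm b + norm (a - b)"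
    by (metis norm_triangle_sub)
  then have "(norm a)\<^sup>2 \<le> (norm b + norm (a - b))\<^sup>2" by (intro power_mono) auto
  also have "\<dots> \<le> (1 + \<delta>) * (norm b)\<^sup>2 + (1 + 1 / \<delta>) * (norm (a - b))\<^sup>2"
  proof -
    have "0 \<le> (\<delta> * norm b - norm (a - b))\<^sup>2 / \<delta>" using \<delta> by simp
    also have "\<dots> = \<delta> * (norm b)\<^sup>2 - 2 * norm b * norm (a - b) + (norm (a - b))\<^sup>2 / \<delta>"
      using \<delta> by (simp add: power2_eq_square field_simps)
    finally show ?thesis by (simp add: power2_eq_square algebra_simps)
  qed
  finally show ?thesis .
qed

text \<open>This form of the triangle inequality in weighted \<open>L\<^sup>2\<close> stays in the extended nonnegative reals, so
  that it can also be used to prove that an energy is finite.\<close>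
lemma nn_integral_sq_norm_le_perturbed:
  fixes a b :: "'a \<Rightarrow> 'b::{real_normed_vector, second_countable_topology}" and w :: "'a \<Rightarrow> real"
  assumes \<delta>: "0 < \<delta>" and w0: "\<And>x. 0 \<le> w x" and S: "S \<subseteq> B"
    and b: "(\<lambda>x. ennreal ((norm (b x))\<^sup>2 * w x) * indicator S x) \<in> borel_measurable M"
    and ab: "(\<lambda>x. ennreal ((norm (a x - b x))\<^sup>2 * w x) * indicator B x) \<in> borel_measurable M"
  shows "(\<integral>\<^sup>+x\<in>S. ennreal ((norm (a x))\<^sup>2 * w x) \<partial>M)
      \<le> ennreal (1 + \<delta>) * (\<integral>\<^sup>+x\<in>S. ennreal ((norm (b x))\<^sup>2 * w x) \<partial>M)
        + ennreal (1 + 1 / \<delta>) * (\<integral>\<^sup>+x\<in>B. ennreal ((norm (a x - b x))\<^sup>2 * w x) \<partial>M)"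
proof -
  have "(\<integral>\<^sup>+x\<in>S. ennreal ((norm (a x))\<^sup>2 * w x) \<partial>M)
      \<le> (\<integral>\<^sup>+x. ennreal (1 + \<delta>) * (ennreal ((norm (b x))\<^sup>2 * w x) * indicator S x)
          + ennreal (1 + 1 / \<delta>) * (ennreal ((norm (a x - b x))\<^sup>2 * w x) * indicator B x) \<partial>M)"
  proof (rule nn_integral_mono)
    fix x
    have "(norm (a x))\<^sup>2 * w x \<le> ((1 + \<delta>) * (norm (b x))\<^sup>2 + (1 + 1 / \<delta>) * (norm (a x - b x))\<^sup>2) * w x"
      using sq_norm_le_perturbed[OF \<delta>] w0 by (intro mult_right_mono) auto
    also have "\<dots> = (1 + \<delta>) * ((norm (b x))\<^sup>2 * w x) + (1 + 1 / \<delta>) * ((norm (a x - b x))\<^sup>2 * w x)"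
      by (simp add: algebra_simps)
    finally have "ennreal ((norm (a x))\<^sup>2 * w x) \<le> ennreal \<dots>" by (rule ennreal_leI)
    also have "\<dots> = ennreal (1 + \<delta>) * ennreal ((norm (b x))\<^sup>2 * w x)
        + ennreal (1 + 1 / \<delta>) * ennreal ((norm (a x - b x))\<^sup>2 * w x)"
      using \<delta> w0[of x] by (subst ennreal_plus) (auto simp: ennreal_mult)
    finally show "ennreal ((norm (a x))\<^sup>2 * w x) * indicator S x
        \<le> ennreal (1 + \<delta>) * (ennreal ((norm (b x))\<^sup>2 * w x) * indicator S x)
          + ennreal (1 + 1 / \<delta>) * (ennreal ((norm (a x - b x))\<^sup>2 * w x) * indicator B x)"
      using S by (auto simp: indicator_def)
  qed
  also have "\<dots> = ennreal (1 + \<delta>) * (\<integral>\<^sup>+x\<in>S. ennreal ((norm (b x))\<^sup>2 * w x) \<partial>M)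
        + ennreal (1 + 1 / \<delta>) * (\<integral>\<^sup>+x\<in>B. ennreal ((norm (a x - b x))\<^sup>2 * w x) \<partial>M)"
    using b ab by (simp add: nn_integral_add nn_integral_cmult)
  finally show ?thesis .
qed

text \<open>If \<open>d n\<close> tends to 0, the parameter \<open>\<delta>\<close> may be fixed first, small compared to the gap between
  \<open>b\<close> and \<open>a\<close>.\<close>
lemma eventually_less_of_perturbed_le:
  fixes X d :: "nat \<Rightarrow> ennreal"
  assumes le: "\<And>n \<delta>. 0 < \<delta> \<Longrightarrow> X n \<le> ennreal (1 + \<delta>) * ennreal b + ennreal (1 + 1 / \<delta>) * d n"
    and d: "d \<longlonglongrightarrow> 0" and b: "0 \<le> b" "b < a"
  shows "\<forall>\<^sub>F n in sequentially. X n < ennreal a"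
proof -
  define \<delta> where "\<delta> = (a - b) / (2 * (b + 1))"
  have \<delta>: "0 < \<delta>" using b by (simp add: \<delta>_def)
  define s where "s = ((a - b) / 2) / (1 + 1 / \<delta>)"
  have s: "0 < s" using b \<delta> by (simp add: s_def add_pos_pos)
  have 1: "(1 + 1 / \<delta>) * s = (a - b) / 2"
  proof -
    have "1 + 1 / \<delta> \<noteq> 0" using \<delta> by (simp add: add_pos_pos less_imp_neq[symmetric])
    then show ?thesis unfolding s_def by (metis nonzero_mult_div_cancel_left times_divide_eq_right)
  qed
  have "\<delta> * b < (a - b) / 2"
    using b by (simp add: \<delta>_def field_simps)
  then have 2: "(1 + \<delta>) * b + (1 + 1 / \<delta>) * s < a"
    unfolding 1 by (simp add: field_simps)
  have "\<forall>\<^sub>F n in sequentially. d n < ennreal s"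
    using d s by (intro order_tendstoD) auto
  then show ?thesis
  proof eventually_elim
    case (elim n)
    have "X n \<le> ennreal (1 + \<delta>) * ennreal b + ennreal (1 + 1 / \<delta>) * ennreal s"
      using le[OF \<delta>, of n] elim by (meson add_left_mono mult_left_mono order_trans less_imp_le zero_le)
    also have "\<dots> = ennreal ((1 + \<delta>) * b + (1 + 1 / \<delta>) * s)"
      using \<delta> s b by (simp add: ennreal_mult ennreal_plus)
    also have "\<dots> < ennreal a" using 2 b by (intro ennreal_lessI) auto
    finally show ?case .
  qed
qed

text \<open>In the following four lemmas \<open>g\<close> is the gradient of an element of the weighted space and
  \<open>\<phi>\<close> a sequence of test functions whose gradients converge to it.\<close>
context
  fixes \<beta> :: real and g :: "plane \<Rightarrow> plane" and \<phi> :: "nat \<Rightarrow> plane \<Rightarrow> real"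
  assumes \<beta>: "0 \<le> \<beta>" "\<beta> < 1"
    and g: "g \<in> borel_measurable (lebesgue_on unit_disc)"
    and test: "\<And>n. test_function (\<phi> n)"
    and lim: "(\<lambda>n. \<integral>\<^sup>+x\<in>unit_disc. ennreal ((norm (gradient (\<phi> n) x - g x))\<^sup>2 * w0 \<beta> x) \<partial>lebesgue) \<longlonglongrightarrow> 0"
begin

lemma measurable_approximation:
  assumes "S \<in> sets borel" "S \<subseteq> unit_disc"
  shows "(\<lambda>x. ennreal ((norm (g x))\<^sup>2 * w0 \<beta> x) * indicator S x) \<in> borel_measurable lebesgue"
    and "(\<lambda>x. ennreal ((norm (gradient (\<phi> n) x))\<^sup>2 * w0 \<beta> x) * indicator S x) \<in> borel_measurable lebesgue"
    and "(\<lambda>x. ennreal ((norm (gradient (\<phi> n) x - g x))\<^sup>2 * w0 \<beta> x) * indicator S x) \<in> borel_measurable lebesgue"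
    and "(\<lambda>x. ennreal ((norm (g x - gradient (\<phi> n) x))\<^sup>2 * w0 \<beta> x) * indicator S x) \<in> borel_measurable lebesgue"
proof -
  define G where "G x = indicator unit_disc x *\<^sub>R g x" for x
  have G[measurable]: "G \<in> borel_measurable lebesgue"
    using g unfolding G_def by (subst (asm) borel_measurable_restrict_space_iff) auto
  have [measurable]: "(indicator S :: plane \<Rightarrow> ennreal) \<in> borel_measurable lebesgue"
    using assms by (intro borel_measurable_indicator) auto
  have "gradient (\<phi> n) \<in> borel_measurable borel"
    by (rule borel_measurable_continuous_onI[OF test_function_gradient(2)[OF test]])
  then have [measurable]: "gradient (\<phi> n) \<in> borel_measurable lebesgue"
    by (intro measurable_completion) simp
  have [measurable]: "w0 \<beta> \<in> borel_measurable lebesgue"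
    by (intro measurable_completion) simp
  have eq: "F (g x) * indicator S x = F (G x) * indicator S x" for F :: "plane \<Rightarrow> ennreal" and x
    using assms(2) by (auto simp: G_def indicator_def)
  show "(\<lambda>x. ennreal ((norm (g x))\<^sup>2 * w0 \<beta> x) * indicator S x) \<in> borel_measurable lebesgue"
    by (subst eq[where F="\<lambda>v. ennreal ((norm v)\<^sup>2 * w0 \<beta> x)" for x]) measurable
  show "(\<lambda>x. ennreal ((norm (gradient (\<phi> n) x))\<^sup>2 * w0 \<beta> x) * indicator S x) \<in> borel_measurable lebesgue"
    by measurable
  show "(\<lambda>x. ennreal ((norm (gradient (\<phi> n) x - g x))\<^sup>2 * w0 \<beta> x) * indicator S x) \<in> borel_measurable lebesgue"
    by (subst eq[where F="\<lambda>v. ennreal ((norm (gradient (\<phi> n) x - v))\<^sup>2 * w0 \<beta> x)" for x]) measurable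
  then show "(\<lambda>x. ennreal ((norm (g x - gradient (\<phi> n) x))\<^sup>2 * w0 \<beta> x) * indicator S x) \<in> borel_measurable lebesgue"
    by (simp add: norm_minus_commute)
qed

text \<open>Finiteness of the energy guarantees that the Bochner integral in the definition of the energy
  is the true value of the integral.\<close>
lemma limit_energy_finite:
  "(\<integral>\<^sup>+x\<in>unit_disc. ennreal ((norm (g x))\<^sup>2 * w0 \<beta> x) \<partial>lebesgue) < \<infinity>"
proof -
  have "\<forall>\<^sub>F n in sequentially. (\<integral>\<^sup>+x\<in>unit_disc. ennreal ((norm (gradient (\<phi> n) x - g x))\<^sup>2 * w0 \<beta> x) \<partial>lebesgue) < 1"
    by (rule order_tendstoD(2)[OF lim]) simp
  then obtain n where n: "(\<integral>\<^sup>+x\<in>unit_disc. ennreal ((norm (gradient (\<phi> n) x - g x))\<^sup>2 * w0 \<beta> x) \<partial>lebesgue) < 1"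
    using eventually_happens'[OF sequentially_bot] by blast
  have fin: "(\<integral>\<^sup>+x\<in>unit_disc. ennreal ((norm (gradient (\<phi> n) x))\<^sup>2 * w0 \<beta> x) \<partial>lebesgue) < \<infinity>"
    using test_function_energy_finite[OF \<beta>(1) _ test, of n] \<beta> by (simp add: nn_integral_completion)
  have "(\<integral>\<^sup>+x\<in>unit_disc. ennreal ((norm (g x))\<^sup>2 * w0 \<beta> x) \<partial>lebesgue)
      \<le> ennreal (1 + 1) * (\<integral>\<^sup>+x\<in>unit_disc. ennreal ((norm (gradient (\<phi> n) x))\<^sup>2 * w0 \<beta> x) \<partial>lebesgue)
        + ennreal (1 + 1 / 1) * (\<integral>\<^sup>+x\<in>unit_disc. ennreal ((norm (g x - gradient (\<phi> n) x))\<^sup>2 * w0 \<beta> x) \<partial>lebesgue)"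
    by (rule nn_integral_sq_norm_le_perturbed[OF zero_less_one w0_nonneg order_refl
          measurable_approximation(2) measurable_approximation(4)]) simp_all
  also have "\<dots> < \<infinity>"
    using fin order.strict_trans[OF n ennreal_one_less_top]
    by (simp add: ennreal_mult_less_top norm_minus_commute[of "g _"])
  finally show ?thesis .
qed

lemma ennreal_limit_energy:
  assumes S: "S \<in> sets borel" "S \<subseteq> unit_disc"
  shows "ennreal (LINT x:S|lebesgue. (norm (g x))\<^sup>2 * w0 \<beta> x)
      = (\<integral>\<^sup>+x\<in>S. ennreal ((norm (g x))\<^sup>2 * w0 \<beta> x) \<partial>lebesgue)"
proof -
  have eq: "ennreal ((norm (g x))\<^sup>2 * w0 \<beta> x) * indicator S x
      = ennreal (indicator S x *\<^sub>R ((norm (g x))\<^sup>2 * w0 \<beta> x))" for x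
    by (auto simp: indicator_def)
  have "(\<lambda>x. enn2real (ennreal ((norm (g x))\<^sup>2 * w0 \<beta> x) * indicator S x)) \<in> borel_measurable lebesgue"
    using measurable_approximation(1)[OF S] by measurable
  then have meas: "(\<lambda>x. indicator S x *\<^sub>R ((norm (g x))\<^sup>2 * w0 \<beta> x)) \<in> borel_measurable lebesgue"
    unfolding eq by simp
  have "(\<integral>\<^sup>+x\<in>S. ennreal ((norm (g x))\<^sup>2 * w0 \<beta> x) \<partial>lebesgue)
      \<le> (\<integral>\<^sup>+x\<in>unit_disc. ennreal ((norm (g x))\<^sup>2 * w0 \<beta> x) \<partial>lebesgue)"
    using S by (intro nn_set_integral_set_mono)
  also note limit_energy_finite
  finally have "integrable lebesgue (\<lambda>x. indicator S x *\<^sub>R ((norm (g x))\<^sup>2 * w0 \<beta> x))"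
    unfolding eq by (intro integrableI_nonneg meas) auto
  then show ?thesis
    unfolding set_lebesgue_integral_def eq by (intro nn_integral_eq_integral[symmetric]) auto
qed

lemma eventually_approximation_energy_less:
  assumes S: "S \<in> sets borel" "S \<subseteq> unit_disc"
    and less: "(LINT x:S|lebesgue. (norm (g x))\<^sup>2 * w0 \<beta> x) < a"
  shows "\<forall>\<^sub>F n in sequentially. (\<integral>\<^sup>+x\<in>S. ennreal ((norm (gradient (\<phi> n) x))\<^sup>2 * w0 \<beta> x) \<partial>lborel) < ennreal a"
proof (rule eventually_less_of_perturbed_le[OF _ lim])
  show "0 \<le> (LINT x:S|lebesgue. (norm (g x))\<^sup>2 * w0 \<beta> x)"
    unfolding set_lebesgue_integral_def by (intro integral_nonneg_AE) auto
  show "(\<integral>\<^sup>+x\<in>S. ennreal ((norm (gradient (\<phi> n) x))\<^sup>2 * w0 \<beta> x) \<partial>lborel)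
      \<le> ennreal (1 + \<delta>) * ennreal (LINT x:S|lebesgue. (norm (g x))\<^sup>2 * w0 \<beta> x)
        + ennreal (1 + 1 / \<delta>) * (\<integral>\<^sup>+x\<in>unit_disc. ennreal ((norm (gradient (\<phi> n) x - g x))\<^sup>2 * w0 \<beta> x) \<partial>lebesgue)"
    if "0 < \<delta>" for n \<delta>
  proof -
    have "(\<integral>\<^sup>+x\<in>S. ennreal ((norm (gradient (\<phi> n) x))\<^sup>2 * w0 \<beta> x) \<partial>lborel)
        = (\<integral>\<^sup>+x\<in>S. ennreal ((norm (gradient (\<phi> n) x))\<^sup>2 * w0 \<beta> x) \<partial>lebesgue)"
      by (rule nn_integral_completion[symmetric])
    also have "\<dots> \<le> ennreal (1 + \<delta>) * (\<integral>\<^sup>+x\<in>S. ennreal ((norm (g x))\<^sup>2 * w0 \<beta> x) \<partial>lebesgue)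
        + ennreal (1 + 1 / \<delta>) * (\<integral>\<^sup>+x\<in>unit_disc. ennreal ((norm (gradient (\<phi> n) x - g x))\<^sup>2 * w0 \<beta> x) \<partial>lebesgue)"
      by (rule nn_integral_sq_norm_le_perturbed[OF that w0_nonneg S(2)
            measurable_approximation(1)[OF S] measurable_approximation(3)]) simp_all
    finally show ?thesis by (simp only: ennreal_limit_energy[OF S])
  qed
qed (rule less)

end

text \<open>The circle means inherit the \<open>L\<^sup>1\<close> convergence to a radial limit, hence a subsequence of them
  converges almost everywhere.\<close>
lemma circle_mean_AE_subseq:
  assumes u[measurable]: "u \<in> borel_measurable borel"
    and rad: "AE x in lborel. x \<in> unit_disc \<longrightarrow> u x = f (norm x)"
    and cont: "\<And>n. continuous_on UNIV (\<phi> n)"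
    and lim: "(\<lambda>n. \<integral>\<^sup>+x\<in>unit_disc. ennreal \<bar>\<phi> n x - u x\<bar> \<partial>lborel) \<longlonglongrightarrow> 0"
  obtains s :: "nat \<Rightarrow> nat" where "strict_mono s"
    "AE x in lborel. x \<in> unit_disc \<longrightarrow> (\<lambda>n. circle_mean (\<phi> (s n)) (norm x)) \<longlonglongrightarrow> u x"
proof -
  define v where "v n x = indicator unit_disc x *\<^sub>R (circle_mean (\<phi> n) (norm x) - u x)" for n and x :: plane
  have [measurable]: "circle_mean (\<phi> n) \<in> borel_measurable borel" for n
    by (intro borel_measurable_continuous_onI continuous_circle_mean cont)
  have [measurable]: "(indicator unit_disc :: plane \<Rightarrow> real) \<in> borel_measurable borel"
    by (rule borel_measurable_indicator) simp
  have [measurable]: "v n \<in> borel_measurable lborel" for n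
    unfolding v_def by measurable
  define d where "d n = (\<integral>\<^sup>+x. ennreal (norm (v n x)) \<partial>lborel)" for n
  have "d \<longlonglongrightarrow> 0"
  proof (rule tendsto_sandwich[OF _ _ tendsto_const lim])
    have "d n \<le> (\<integral>\<^sup>+x\<in>unit_disc. ennreal \<bar>\<phi> n x - u x\<bar> \<partial>lborel)" for n
    proof -
      have "d n = (\<integral>\<^sup>+x\<in>unit_disc. ennreal \<bar>circle_mean (\<phi> n) (norm x) - u x\<bar> \<partial>lborel)"
        unfolding d_def by (intro nn_integral_cong) (auto simp: v_def indicator_def)
      also have "\<dots> \<le> (\<integral>\<^sup>+x\<in>unit_disc. ennreal \<bar>\<phi> n x - u x\<bar> \<partial>lborel)"
        by (rule nn_integral_circle_mean_diff_le[OF cont u rad])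
      finally show ?thesis .
    qed
    then show "\<forall>\<^sub>F n in sequentially. d n \<le> (\<integral>\<^sup>+x\<in>unit_disc. ennreal \<bar>\<phi> n x - u x\<bar> \<partial>lborel)"
      by (rule always_eventually[OF allI])
  qed auto
  then have "\<forall>\<^sub>F n in sequentially. d n < 1" by (intro order_tendstoD) auto
  then obtain N where N: "\<And>n. N \<le> n \<Longrightarrow> d n < 1" by (auto simp: eventually_sequentially)
  have int: "integrable lborel (v (n + N))" for n
  proof (rule integrableI_bounded)
    show "(\<integral>\<^sup>+x. ennreal (norm (v (n + N) x)) \<partial>lborel) < \<infinity>"
      using order.strict_trans[OF N[of "n + N"] ennreal_one_less_top] by (simp add: d_def)
  qed simp
  have "(\<lambda>n. enn2real (d (n + N))) \<longlonglongrightarrow> enn2real 0"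
    using \<open>d \<longlonglongrightarrow> 0\<close> by (intro tendsto_enn2real LIMSEQ_ignore_initial_segment) auto
  moreover have "enn2real (d (n + N)) = (\<integral>x. norm (v (n + N) x) \<partial>lborel)" for n
    unfolding d_def using integral_eq_nn_integral[of "\<lambda>x. norm (v (n + N) x)" lborel] by simp
  ultimately have "(\<lambda>n. \<integral>x. norm (v (n + N) x) \<partial>lborel) \<longlonglongrightarrow> 0" by simp
  from tendsto_L1_AE_subseq[of lborel "\<lambda>n. v (n + N)", OF int this]
  obtain r :: "nat \<Rightarrow> nat" where r: "strict_mono r" "AE x in lborel. (\<lambda>n. v (r n + N) x) \<longlonglongrightarrow> 0" by blast
  show ?thesis
  proof (rule that[of "\<lambda>n. r n + N"])
    show "strict_mono (\<lambda>n. r n + N)" using r(1) by (simp add: strict_mono_def)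
    show "AE x in lborel. x \<in> unit_disc \<longrightarrow> (\<lambda>n. circle_mean (\<phi> (r n + N)) (norm x)) \<longlonglongrightarrow> u x"
      using r(2)
    proof eventually_elim
      case (elim x)
      show ?case
      proof
        assume "x \<in> unit_disc"
        then have "(\<lambda>n. circle_mean (\<phi> (r n + N)) (norm x) - u x) \<longlonglongrightarrow> 0" using elim by (simp add: v_def)
        then show "(\<lambda>n. circle_mean (\<phi> (r n + N)) (norm x)) \<longlonglongrightarrow> u x" by (rule LIM_zero_cancel)
      qed
    qed
  qed
qed

section \<open>The concentration level\<close>

text \<open>The energy of the approximating test functions may exceed 1 slightly. They are therefore
  multiplied by factors \<open>c n \<longlonglongrightarrow> 1\<close> that bring their energy down to at most 1. Their circle means obey
  the bound for smooth profiles, and Fatou's lemma along an almost everywhere convergent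
  subsequence carries the bound over to \<open>u\<close>.\<close>
lemma J_le:
  assumes \<beta>: "0 \<le> \<beta>" "\<beta> < 1"
    and u: "u \<in> H10_rad \<beta>" and norm_le: "weighted_norm \<beta> u \<le> 1"
    and tail: "energy \<beta> u (unit_disc - ball 0 (exp (- A / 2))) < \<eta>"
    and A: "3 \<le> A" and \<eta>: "0 < \<eta>" "\<eta> < 1 - 2 * ln A / A"
  shows "J \<beta> u \<le> ennreal (exp (A * \<eta>) + 1 / A + exp 1 / (1 - 2 * ln A / A))"
proof -
  define C where "C = exp (A * \<eta>) + 1 / A + exp 1 / (1 - 2 * ln A / A)"
  have C: "0 \<le> C"
    unfolding C_def using A two_ln_less[of A] by (intro add_nonneg_nonneg divide_nonneg_nonneg) auto
  define g where "g = weak_gradient \<beta> u"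
  have "\<exists>g. H10_gradient \<beta> u g" using u by (simp add: H10_rad_def H10_def)
  then have "H10_gradient \<beta> u g" unfolding g_def weak_gradient_def by (rule someI_ex)
  then obtain \<phi> where um: "u \<in> borel_measurable (lebesgue_on unit_disc)"
    and gm: "g \<in> borel_measurable (lebesgue_on unit_disc)"
    and test: "\<And>n. test_function (\<phi> n)"
    and lim: "(\<lambda>n. \<integral>\<^sup>+x\<in>unit_disc. ennreal ((norm (gradient (\<phi> n) x - g x))\<^sup>2 * w0 \<beta> x) \<partial>lebesgue) \<longlonglongrightarrow> 0"
    and limL1: "(\<lambda>n. \<integral>\<^sup>+x\<in>unit_disc. ennreal \<bar>\<phi> n x - u x\<bar> \<partial>lebesgue) \<longlonglongrightarrow> 0"
    unfolding H10_gradient_def by blast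
  note approx = eventually_approximation_energy_less[OF \<beta> gm test lim]
  define e where "e n = (\<integral>\<^sup>+x\<in>unit_disc. ennreal ((norm (gradient (\<phi> n) x))\<^sup>2 * w0 \<beta> x) \<partial>lborel)" for n
  define m where "m n = max 1 (enn2real (e n))" for n
  define c where "c n = 1 / sqrt (m n)" for n
  have e_fin: "ennreal (enn2real (e n)) = e n" for n
    using test_function_energy_finite[OF \<beta>(1) _ test, of n] \<beta> by (simp add: e_def)
  have m1: "1 \<le> m n" for n by (simp add: m_def)
  have e_le_m: "e n \<le> ennreal (m n)" for n
    by (subst e_fin[symmetric]) (simp add: m_def ennreal_leI)
  have "energy \<beta> u unit_disc \<le> 1"
    using norm_le by (simp add: weighted_norm_def)
  then have E1: "(LINT x:unit_disc|lebesgue. (norm (g x))\<^sup>2 * w0 \<beta> x) \<le> 1"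
    by (simp add: energy_def g_def)
  have "m \<longlonglongrightarrow> 1"
  proof (rule order_tendstoI)
    show "\<forall>\<^sub>F n in sequentially. a < m n" if "a < 1" for a
      using m1 that by (intro always_eventually allI) (meson less_le_trans)
    show "\<forall>\<^sub>F n in sequentially. m n < a" if "1 < a" for a
    proof -
      have "\<forall>\<^sub>F n in sequentially. e n < ennreal a"
        unfolding e_def using E1 that by (intro approx) auto
      then show ?thesis
      proof eventually_elim
        case (elim n)
        then have "ennreal (enn2real (e n)) < ennreal a" by (simp only: e_fin)
        then show ?case using that by (simp add: m_def ennreal_less_iff)
      qed
    qed
  qed
  then have "c \<longlonglongrightarrow> 1 / sqrt 1"
    unfolding c_def by (intro tendsto_intros) auto
  then have c_lim: "c \<longlonglongrightarrow> 1" by simp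
  have c: "0 < c n" "c n \<le> 1" "(c n)\<^sup>2 = 1 / m n" for n
    using m1[of n] by (auto simp: c_def power_divide)
  have scaled: "(\<integral>\<^sup>+x\<in>S. ennreal ((norm (c n *\<^sub>R gradient (\<phi> n) x))\<^sup>2 * w0 \<beta> x) \<partial>lborel)
      = ennreal ((c n)\<^sup>2) * (\<integral>\<^sup>+x\<in>S. ennreal ((norm (gradient (\<phi> n) x))\<^sup>2 * w0 \<beta> x) \<partial>lborel)"
    if "S \<in> sets borel" for S n
  proof -
    have [measurable]: "gradient (\<phi> n) \<in> borel_measurable borel"
      by (rule borel_measurable_continuous_onI[OF test_function_gradient(2)[OF test]])
    have [measurable]: "(indicator S :: plane \<Rightarrow> ennreal) \<in> borel_measurable borel"
      using that by (rule borel_measurable_indicator)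
    have "(\<integral>\<^sup>+x\<in>S. ennreal ((norm (c n *\<^sub>R gradient (\<phi> n) x))\<^sup>2 * w0 \<beta> x) \<partial>lborel)
        = (\<integral>\<^sup>+x. ennreal ((c n)\<^sup>2) * (ennreal ((norm (gradient (\<phi> n) x))\<^sup>2 * w0 \<beta> x) * indicator S x) \<partial>lborel)"
      by (intro nn_integral_cong) (simp add: power_mult_distrib ennreal_mult' mult_ac)
    also have "\<dots> = ennreal ((c n)\<^sup>2) * (\<integral>\<^sup>+x\<in>S. ennreal ((norm (gradient (\<phi> n) x))\<^sup>2 * w0 \<beta> x) \<partial>lborel)"
      by (rule nn_integral_cmult) measurable
    finally show ?thesis .
  qed
  have "(LINT x:unit_disc - ball 0 (exp (- A / 2))|lebesgue. (norm (g x))\<^sup>2 * w0 \<beta> x) < \<eta>"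
    using tail by (simp add: energy_def g_def)
  then have tail': "\<forall>\<^sub>F n in sequentially. (\<integral>\<^sup>+x\<in>unit_disc - ball 0 (exp (- A / 2)).
      ennreal ((norm (gradient (\<phi> n) x))\<^sup>2 * w0 \<beta> x) \<partial>lborel) < ennreal \<eta>"
    by (intro approx) auto
  define p where "p = 2 / (1 - \<beta>)"
  have p: "0 < p" using \<beta> by (simp add: p_def)
  define F where "F n x = ennreal (exp (alpha \<beta> * \<bar>c n * circle_mean (\<phi> n) (norm x)\<bar> powr p)) * indicator unit_disc x"
    for n and x :: plane
  have bound: "\<forall>\<^sub>F n in sequentially. (\<integral>\<^sup>+x. F n x \<partial>lborel) \<le> ennreal pi * ennreal C"
    using tail'
  proof eventually_elim
    case (elim n)
    obtain R where R: "0 < R" "R < 1" "\<And>x. R \<le> norm x \<Longrightarrow> \<phi> n x = 0"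
      using test_function_support[OF test[of n]] by blast
    have "(\<integral>\<^sup>+x\<in>unit_disc. ennreal (exp (alpha \<beta> * \<bar>circle_mean (\<lambda>x. c n * \<phi> n x) (norm x)\<bar> powr (2 / (1 - \<beta>)))) \<partial>lborel)
        \<le> ennreal pi * ennreal C"
      unfolding C_def
    proof (rule disc_moser_bound[OF \<beta> _ _ R(1,2)])
      show "GDERIV (\<lambda>x. c n * \<phi> n x) x :> c n *\<^sub>R gradient (\<phi> n) x" for x
        using GDERIV_mult[OF GDERIV_const test_function_gradient(1)[OF test]] by simp
      show "continuous_on UNIV (\<lambda>x. c n *\<^sub>R gradient (\<phi> n) x)"
        by (intro continuous_intros test_function_gradient(2)[OF test])
      show "c n * \<phi> n x = 0" if "R \<le> norm x" for x using R(3)[OF that] by simp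
      have "ennreal ((c n)\<^sup>2) * e n \<le> ennreal ((c n)\<^sup>2) * ennreal (m n)"
        by (intro mult_left_mono e_le_m) auto
      also have "\<dots> = 1" using m1[of n] by (simp add: c ennreal_mult'[symmetric])
      finally show "(\<integral>\<^sup>+x\<in>unit_disc. ennreal ((norm (c n *\<^sub>R gradient (\<phi> n) x))\<^sup>2 * w0 \<beta> x) \<partial>lborel) \<le> 1"
        by (subst scaled) (simp_all add: e_def)
      have "ennreal ((c n)\<^sup>2) * (\<integral>\<^sup>+x\<in>unit_disc - ball 0 (exp (- A / 2)). ennreal ((norm (gradient (\<phi> n) x))\<^sup>2 * w0 \<beta> x) \<partial>lborel)
          \<le> 1 * ennreal \<eta>"
        using elim m1[of n] by (intro mult_mono) (auto simp: c)
      then show "(\<integral>\<^sup>+x\<in>unit_disc - ball 0 (exp (- A / 2)). ennreal ((norm (c n *\<^sub>R gradient (\<phi> n) x))\<^sup>2 * w0 \<beta> x) \<partial>lborel) \<le> ennreal \<eta>"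
        by (subst scaled) simp_all
    qed (use A \<eta> in auto)
    then show ?case by (simp add: F_def circle_mean_scale p_def)
  qed
  obtain f where "AE x in lebesgue_on unit_disc. u x = f (norm x)"
    using u by (auto simp: H10_rad_def radial_def)
  then have rad: "AE x in lborel. x \<in> unit_disc \<longrightarrow> u x = f (norm x)"
    by (simp add: AE_restrict_space_iff AE_completion_iff)
  \<comment> \<open>\<open>u\<close> is only Lebesgue measurable; Fubini's theorem needs the Borel version \<open>v\<close>.\<close>
  have "(\<lambda>x. indicator unit_disc x *\<^sub>R u x) \<in> borel_measurable lebesgue"
    using um by (subst (asm) borel_measurable_restrict_space_iff) auto
  from completion_ex_borel_measurable_real[OF this]
  obtain v where v: "v \<in> borel_measurable borel" "AE x in lborel. indicator unit_disc x *\<^sub>R u x = v x"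
    by auto
  have uv: "AE x in lborel. x \<in> unit_disc \<longrightarrow> u x = v x"
    using v(2) by eventually_elim auto
  have radv: "AE x in lborel. x \<in> unit_disc \<longrightarrow> v x = f (norm x)"
    using rad uv by eventually_elim auto
  have cont\<phi>: "continuous_on UNIV (\<phi> n)" for n
    using test_function_gradient(1)[OF test]
    by (auto simp: gderiv_def intro!: has_derivative_continuous continuous_at_imp_continuous_on)
  have "(\<integral>\<^sup>+x\<in>unit_disc. ennreal \<bar>\<phi> n x - u x\<bar> \<partial>lebesgue) = (\<integral>\<^sup>+x\<in>unit_disc. ennreal \<bar>\<phi> n x - v x\<bar> \<partial>lborel)" for n
    unfolding nn_integral_completion
    by (rule nn_integral_cong_AE) (use uv in eventually_elim, auto simp: indicator_def)
  then have "(\<lambda>n. \<integral>\<^sup>+x\<in>unit_disc. ennreal \<bar>\<phi> n x - v x\<bar> \<partial>lborel) \<longlonglongrightarrow> 0"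
    using limL1 by simp
  from circle_mean_AE_subseq[OF v(1) radv cont\<phi> this]
  obtain s where s: "strict_mono s"
    "AE x in lborel. x \<in> unit_disc \<longrightarrow> (\<lambda>n. circle_mean (\<phi> (s n)) (norm x)) \<longlonglongrightarrow> v x" by blast
  have [measurable]: "F n \<in> borel_measurable lborel" for n
  proof -
    have [measurable]: "circle_mean (\<phi> n) \<in> borel_measurable borel"
      by (intro borel_measurable_continuous_onI continuous_circle_mean cont\<phi>)
    have [measurable]: "(indicator unit_disc :: plane \<Rightarrow> ennreal) \<in> borel_measurable borel"
      by (rule borel_measurable_indicator) simp
    show ?thesis unfolding F_def by measurable
  qed
  have "(\<integral>\<^sup>+x\<in>unit_disc. ennreal (exp (alpha \<beta> * \<bar>u x\<bar> powr p)) \<partial>lebesgue)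
      = (\<integral>\<^sup>+x. liminf (\<lambda>n. F (s n) x) \<partial>lborel)"
    unfolding nn_integral_completion
  proof (rule nn_integral_cong_AE)
    show "AE x in lborel. ennreal (exp (alpha \<beta> * \<bar>u x\<bar> powr p)) * indicator unit_disc x = liminf (\<lambda>n. F (s n) x)"
      using s(2) uv
    proof eventually_elim
      case (elim x)
      show ?case
      proof (cases "x \<in> unit_disc")
        case True
        have "(\<lambda>n. c (s n)) \<longlonglongrightarrow> 1"
          using LIMSEQ_subseq_LIMSEQ[OF c_lim s(1)] by (simp add: o_def)
        then have "(\<lambda>n. c (s n) * circle_mean (\<phi> (s n)) (norm x)) \<longlonglongrightarrow> 1 * u x"
          using elim True by (intro tendsto_mult) auto
        then have "(\<lambda>n. \<bar>c (s n) * circle_mean (\<phi> (s n)) (norm x)\<bar> powr p) \<longlonglongrightarrow> \<bar>1 * u x\<bar> powr p"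
          by (intro tendsto_powr' tendsto_rabs tendsto_const) (use p in auto)
        then have "(\<lambda>n. F (s n) x) \<longlonglongrightarrow> ennreal (exp (alpha \<beta> * \<bar>1 * u x\<bar> powr p)) * indicator unit_disc x"
          using True unfolding F_def by (auto intro!: tendsto_intros)
        then show ?thesis using lim_imp_Liminf[OF trivial_limit_sequentially] by fastforce
      qed (simp add: F_def Liminf_const)
    qed
  qed
  also have "\<dots> \<le> liminf (\<lambda>n. \<integral>\<^sup>+x. F (s n) x \<partial>lborel)"
    by (rule nn_integral_liminf) measurable
  also have "\<dots> \<le> ennreal pi * ennreal C"
  proof -
    have "\<forall>\<^sub>F n in sequentially. (\<integral>\<^sup>+x. F (s n) x \<partial>lborel) \<le> ennreal pi * ennreal C"
      using eventually_subseq[OF s(1) bound] .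
    then have "limsup (\<lambda>n. \<integral>\<^sup>+x. F (s n) x \<partial>lborel) \<le> ennreal pi * ennreal C"
      by (rule Limsup_bounded)
    then show ?thesis
      using Liminf_le_Limsup[OF trivial_limit_sequentially, of "\<lambda>n. \<integral>\<^sup>+x. F (s n) x \<partial>lborel"] by (rule order_trans[rotated])
  qed
  finally have *: "(\<integral>\<^sup>+x\<in>unit_disc. ennreal (exp (alpha \<beta> * \<bar>u x\<bar> powr p)) \<partial>lebesgue) \<le> ennreal (pi * C)"
    using C by (simp add: ennreal_mult)
  have "emeasure lebesgue unit_disc = ennreal pi"
    by (simp add: emeasure_ball unit_ball_vol_2)
  then have "J \<beta> u \<le> ennreal (pi * C) / ennreal pi"
    unfolding J_def p_def[symmetric] using * by (simp add: divide_right_mono_ennreal)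
  also have "\<dots> = ennreal C" using C by (simp add: divide_ennreal)
  finally show ?thesis by (simp add: C_def)
qed

theorem lemma9:
  fixes \<beta> :: real
  assumes "0 \<le> \<beta>" and "\<beta> < 1"
  shows "concentration_level_0 \<beta> \<le> ennreal (1 + exp 1)"
  unfolding concentration_level_0_def
proof (rule Sup_least, clarify)
  fix u assume H: "\<forall>m. u m \<in> H10_rad \<beta>" and conc: "concentrates_at_0 \<beta> u"
  show "limsup (\<lambda>m. J \<beta> (u m)) \<le> ennreal (1 + exp 1)"
  proof (rule ennreal_le_epsilon)
    fix \<epsilon> :: real assume "0 < \<epsilon>"
    then obtain A \<eta> where A: "3 \<le> A" and \<eta>: "0 < \<eta>" "\<eta> < 1 - 2 * ln A / A"
      and le: "exp (A * \<eta>) + 1 / A + exp 1 / (1 - 2 * ln A / A) \<le> 1 + exp 1 + \<epsilon>"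
      by (rule concentrated_moser_parameters)
    have "exp (- A / 2) \<in> {0<..<1}" using A by simp
    then have "(\<lambda>k. energy \<beta> (u k) (unit_disc - ball 0 (exp (- A / 2)))) \<longlonglongrightarrow> 0"
      using conc unfolding concentrates_at_0_def by blast
    then have "\<forall>\<^sub>F k in sequentially. energy \<beta> (u k) (unit_disc - ball 0 (exp (- A / 2))) < \<eta>"
      using \<eta>(1) by (rule order_tendstoD)
    then have "\<forall>\<^sub>F k in sequentially. J \<beta> (u k) \<le> ennreal (1 + exp 1) + ennreal \<epsilon>"
    proof eventually_elim
      case (elim k)
      have "J \<beta> (u k) \<le> ennreal (exp (A * \<eta>) + 1 / A + exp 1 / (1 - 2 * ln A / A))"
        by (rule J_le[OF assms _ _ elim A \<eta>]) (use H conc in \<open>auto simp: concentrates_at_0_def\<close>)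
      also have "\<dots> \<le> ennreal (1 + exp 1 + \<epsilon>)" using le by (rule ennreal_leI)
      also have "\<dots> = ennreal (1 + exp 1) + ennreal \<epsilon>"
        using \<open>0 < \<epsilon>\<close> by (intro ennreal_plus) (auto simp: add_nonneg_nonneg)
      finally show ?case .
    qed
    then show "limsup (\<lambda>m. J \<beta> (u m)) \<le> ennreal (1 + exp 1) + ennreal \<epsilon>"
      by (rule Limsup_bounded)
  qed
qed

end
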